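(* Let $\alpha\ge 1$, $\beta\ge 1$, $m\ge 1$ and $n\ge 1$ be integers. Let $S_n$ be the number of white balls drawn in the first $n$ draws from a Pólya-Eggenberger urn that initially contains $\alpha$ white and $\beta$ black balls and in which each drawn ball is replaced along with $m$ additional balls of the same color. Then, with $W_n=S_n/n$ and $Z$ a random variable with the Beta distribution $\mathcal B(\alpha/m,\beta/m)$, $$d_W(W_n,Z)\le \left(\frac{m+\max(\alpha,\beta)}{2nm}+\frac{\alpha\beta}{nm(\alpha+\beta)}\right)(b_0+b_1)+\frac{3}{2n},$$ where $b_0=b_0(\alpha/m,\beta/m)$ and $b_1=b_1(\alpha/m,\beta/m)$ are the values of the functions $b_0(\cdot,\cdot)$, $b_1(\cdot,\cdot)$ given in the context.
   Context: Pólya-Eggenberger urn: at time zero the urn contains $\alpha\ge1$ white and $\beta\ge1$ black balls; at every positive integer time a ball is chosen uniformly from the urn, independently of the past, and replaced along with $m\ge 1$ additional balls of the same color. For real $a,b>0$, $\mathcal B(a,b)$ is the Beta distribution on $[0,1]$ with density $x^{a-1}(1-x)^{b-1}/B(a,b)$, where $B(a,b)=\Gamma(a)\Gamma(b)/\Gamma(a+b)$. Wasserstein distance: $d_W(X,Y)=\sup_{h\in \mathrm{Lip}(1)}|\mathbb E[h(X)]-\mathbb E[h(Y)]|$, where $\mathrm{Lip}(1)=\{h:|h(x)-h(y)|\le|x-y|\}$ is the class of real functions with Lipschitz constant at most 1. For real $a,b>0$ define $$b_0(a,b)=\begin{cases}4\max(|a-1|,|b-1|) & a\le2,\ b\le2,\\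 (a+b-2)^2\max\left(\frac{a-1}{(a-2)^2},\frac{|b-1|}{b^2}\right) & a>2,\ b\le2,\\ (a+b-2)^2\max\left(\frac{|a-1|}{a^2},\frac{b-1}{(b-2)^2}\right) & a\le2,\ b>2,\\ (a+b-2)^2\max\left(\frac1{a-1},\frac1{b-1}\right) & a>2,\ b>2,\end{cases}$$ $$b_1(a,b)=\begin{cases}4\left(1+\frac{\max(a,b)}{a+b}\right) & a\le2,\ b\le2,\\ \frac{(a+b-2)^2}{\min(a-2,b)^2}+2\max\left(\frac{a}{a-2},1\right) & a>2,\ b\le2,\\ \frac{(a+b-2)^2}{\min(a,b-2)^2}+2\max\left(1,\frac{b}{b-2}\right) & a\le2,\ b>2,\\ \frac{(a+b-2)^2}{\min(a-1,b-1)^2}+2\max\left(\frac{a}{a-1},\frac{b}{b-1}\right) & a>2,\ b>2.\end{cases}$$ *)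

theory Defs
  imports "HOL-Probability.Probability" "HOL-Library.Multiset"
begin

datatype colour = White | Black

text \<open>The contents of the urn after the colours \<open>cs\<close> have been drawn.\<close>

definition urn :: "nat \<Rightarrow> nat \<Rightarrow> nat \<Rightarrow> colour list \<Rightarrow> colour multiset" where
  "urn \<alpha> \<beta> m cs = replicate_mset \<alpha> White + replicate_mset \<beta> Black + repeat_mset m (mset cs)"

text \<open>
  \<open>D k\<close> is the colour of the ball drawn at time \<open>k + 1\<close>. Its conditional distribution, given the
  colours drawn earlier, is that of a uniformly chosen ball of the current urn.
\<close>

definition polya_urn ::
  "'a measure \<Rightarrow> nat \<Rightarrow> nat \<Rightarrow> nat \<Rightarrow> (nat \<Rightarrow> 'a \<Rightarrow> colour) \<Rightarrow> bool" where
  "polya_urn M \<alpha> \<beta> m D \<longleftrightarrow>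
     (\<forall>k. D k \<in> measurable M (count_space UNIV)) \<and>
     (\<forall>k cs c. length cs = k \<longrightarrow>
        \<P>(\<omega> in M. map (\<lambda>i. D i \<omega>) [0..<k] = cs) \<noteq> 0 \<longrightarrow>
        \<P>(\<omega> in M. D k \<omega> = c \<bar> map (\<lambda>i. D i \<omega>) [0..<k] = cs)
          = pmf (pmf_of_multiset (urn \<alpha> \<beta> m cs)) c)"

definition white_draws :: "(nat \<Rightarrow> 'a \<Rightarrow> colour) \<Rightarrow> nat \<Rightarrow> 'a \<Rightarrow> nat" where
  "white_draws D n \<omega> = card {i. i < n \<and> D i \<omega> = White}"

definition beta_density :: "real \<Rightarrow> real \<Rightarrow> real \<Rightarrow> real" where
  "beta_density a b x =
     (if 0 \<le> x \<and> x \<le> 1 then x powr (a - 1) * (1 - x) powr (b - 1) / Beta a b else 0)"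

text \<open>
  The supremum is taken in \<^typ>\<open>ereal\<close>, so that a real upper bound asserts that it is finite.
  The two variables may live on different probability spaces. The definition is meaningful for
  integrable \<open>X\<close> and \<open>Y\<close>, since a Bochner integral that does not exist is \<open>0\<close>.
\<close>

definition wasserstein_dist ::
  "'a measure \<Rightarrow> ('a \<Rightarrow> real) \<Rightarrow> 'b measure \<Rightarrow> ('b \<Rightarrow> real) \<Rightarrow> ereal" where
  "wasserstein_dist M X N Y =
     (SUP h \<in> {h :: real \<Rightarrow> real. 1-lipschitz_on UNIV h}.
        ereal \<bar>(\<integral>\<omega>. h (X \<omega>) \<partial>M) - (\<integral>\<omega>. h (Y \<omega>) \<partial>N)\<bar>)"

definition b0 :: "real \<Rightarrow> real \<Rightarrow> real" where
  "b0 a b =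
    (if a \<le> 2 \<and> b \<le> 2 then 4 * max \<bar>a - 1\<bar> \<bar>b - 1\<bar>
     else if a > 2 \<and> b \<le> 2 then (a + b - 2)\<^sup>2 * max ((a - 1) / (a - 2)\<^sup>2) (\<bar>b - 1\<bar> / b\<^sup>2)
     else if a \<le> 2 \<and> b > 2 then (a + b - 2)\<^sup>2 * max (\<bar>a - 1\<bar> / a\<^sup>2) ((b - 1) / (b - 2)\<^sup>2)
     else (a + b - 2)\<^sup>2 * max (1 / (a - 1)) (1 / (b - 1)))"

definition b1 :: "real \<Rightarrow> real \<Rightarrow> real" where
  "b1 a b =
    (if a \<le> 2 \<and> b \<le> 2 then 4 * (1 + max a b / (a + b))
     else if a > 2 \<and> b \<le> 2 then
       (a + b - 2)\<^sup>2 / (min (a - 2) b)\<^sup>2 + 2 * max (a / (a - 2)) 1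
     else if a \<le> 2 \<and> b > 2 then
       (a + b - 2)\<^sup>2 / (min a (b - 2))\<^sup>2 + 2 * max 1 (b / (b - 2))
     else
       (a + b - 2)\<^sup>2 / (min (a - 1) (b - 1))\<^sup>2 + 2 * max (a / (a - 1)) (b / (b - 1)))"

end

theory Submission
  imports Defs
begin

text \<open>
  The proof is Stein's method. Write \<open>a = \<alpha> / m\<close> and \<open>b = \<beta> / m\<close>, let \<open>S\<close> be the number of white
  draws and \<open>W = S / n\<close>, and let \<open>h\<close> be 1-Lipschitz. For the beta distribution the Stein equation
  \<open>w (1 - w) f'(w) + (a - (a + b) w) f(w) = h(w) - E h(Z)\<close> has a solution \<open>f\<close> on \<open>[0, 1]\<close>, so that
  \<open>E h(W) - E h(Z)\<close> is the expectation of the left-hand side at \<open>w = W\<close>.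

  On the discrete side, the recursion for the law of \<open>S\<close> shows that consecutive probabilities have a
  rational ratio, and hence that \<open>E[S (b + n - S) g(S)] = E[(n - S) (a + S) g(S + 1)]\<close> for every \<open>g\<close>.
  With \<open>g(k) = f(k / n)\<close> this says that
  \<open>n W (1 - W) (f(W + 1/n) - f(W)) + a (1 - W) f(W + 1/n) - b W f(W)\<close> has expectation zero: it is the
  left-hand side of the Stein equation with \<open>f'\<close> replaced by a difference quotient and \<open>f(W)\<close> replaced
  by \<open>f(W + 1/n)\<close> in one place. What remains is to compare the two. Replacing \<open>f(W)\<close> costs at most
  \<open>a (1 - W) sup |f'| / n\<close>, and \<open>E(1 - W) = b / (a + b)\<close>. Replacing the derivative would naively need a
  bound on \<open>f''\<close>, but only \<open>w (1 - w) f'(w)\<close> has to vary little, and the Stein equation expresses that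
  product through \<open>h\<close> and \<open>f\<close>. So bounds on \<open>f\<close> and \<open>f'\<close> suffice.

  Those bounds are \<open>(a + b) |f| \<le> 1\<close> and \<open>|f'| \<le> 6\<close>, whatever \<open>a, b > 0\<close> are. For the first, the test
  function \<open>h(x) = - x\<close> has the constant solution \<open>f = 1 / (a + b)\<close>, and it is extremal because \<open>h(x) - x\<close>
  and \<open>- h(x) - x\<close> are nonincreasing. For the second, \<open>f'\<close> solves the Stein equation for the parameters
  \<open>a + 1\<close>, \<open>b + 1\<close> and the right-hand side \<open>h' + (a + b) f\<close>, which is bounded by 2; so it is enough that the
  smaller tail of that beta distribution is at most \<open>3 x (1 - x)\<close> times its density. This is
  \<open>primitive_bound\<close>. Finally \<open>b0 a b + b1 a b \<ge> 6\<close> in all cases, so the uniform bound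
  on \<open>f'\<close> is at least as good as the one required. The estimate is first proved for differentiable \<open>h\<close>;
  moving averages extend it to all 1-Lipschitz functions.
\<close>

section \<open>The law of the number of white draws\<close>

lemma pmf_urn:
  assumes "\<alpha> \<ge> 1"
  shows "pmf (pmf_of_multiset (urn \<alpha> \<beta> m cs)) c =
    (if c = White then real \<alpha> + real m * real (count_list cs White)
     else real \<beta> + real m * (real (length cs) - real (count_list cs White)))
    / (real \<alpha> + real \<beta> + real m * real (length cs))"
proof -
  have len: "length cs = count_list cs White + count_list cs Black"
  proof (induction cs)
    case (Cons x xs)
    then show ?case by (cases x) auto
  qed simp
  have ne: "urn \<alpha> \<beta> m cs \<noteq> {#}"
    using assms by (auto simp: urn_def)
  have size: "size (urn \<alpha> \<beta> m cs) = \<alpha> + \<beta> + m * length cs"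
    by (simp add: urn_def)
  show ?thesis
    unfolding pmf_of_multiset[OF ne] size by (cases c) (simp_all add: urn_def count_mset len)
qed

text \<open>
  The composition of the urn after a list of draws depends only on the number of white ones among
  them. So the conditional law of the next colour is the same for all histories with \<open>k\<close> white
  draws, and can be summed over these histories.
\<close>

lemma prob_white_draws_and_colour:
  assumes M: "prob_space M" and urn: "polya_urn M \<alpha> \<beta> m D" and "\<alpha> \<ge> 1"
  shows "\<P>(\<omega> in M. white_draws D n \<omega> = k \<and> D n \<omega> = c) =
    \<P>(\<omega> in M. white_draws D n \<omega> = k) *
    ((if c = White then real \<alpha> + real m * real k
     else real \<beta> + real m * (real n - real k)) / (real \<alpha> + real \<beta> + real m * real n))"
proof -
  interpret prob_space M by fact
  have D[measurable]: "D i \<in> measurable M (count_space UNIV)" for i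
    using urn by (auto simp: polya_urn_def)
  define E where "E cs = {\<omega> \<in> space M. map (\<lambda>i. D i \<omega>) [0..<n] = cs}" for cs
  define S where "S = {cs. length cs = n \<and> count_list cs White = k}"
  have E_sets: "E cs \<in> sets M" for cs
  proof -
    have "E cs = {\<omega> \<in> space M. length cs = n \<and> (\<forall>i<n. D i \<omega> = cs ! i)}"
      by (auto simp: E_def list_eq_iff_nth_eq)
    also have "\<dots> \<in> sets M" by measurable
    finally show ?thesis .
  qed
  have "finite {cs :: colour list. set cs \<subseteq> {White, Black} \<and> length cs = n}"
    by (rule finite_lists_length_eq) simp
  moreover have "set cs \<subseteq> {White, Black}" for cs
    using colour.exhaust by blast
  ultimately have "finite S"
    by (auto simp: S_def intro: finite_subset[rotated])
  have wd: "white_draws D n \<omega> = count_list (map (\<lambda>i. D i \<omega>) [0..<n]) White" for \<omega>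
  proof -
    have "{i. i < n \<and> D i \<omega> = White} = {i. i < length (map (\<lambda>i. D i \<omega>) [0..<n]) \<and> White = map (\<lambda>i. D i \<omega>) [0..<n] ! i}"
      by auto
    then show ?thesis
      unfolding white_draws_def count_list_eq_length_filter length_filter_conv_card by simp
  qed
  \<comment> \<open>Needed for the event that the next ball has colour \<open>c\<close> and for the sure event.\<close>
  have split: "\<P>(\<omega> in M. white_draws D n \<omega> = k \<and> Q \<omega>) = (\<Sum>cs\<in>S. prob (E cs \<inter> {\<omega> \<in> space M. Q \<omega>}))"
    if [measurable]: "Measurable.pred M Q" for Q
  proof -
    have "{\<omega> \<in> space M. white_draws D n \<omega> = k \<and> Q \<omega>} = (\<Union>cs\<in>S. E cs \<inter> {\<omega> \<in> space M. Q \<omega>})"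
      by (auto simp: S_def E_def wd)
    moreover have "disjoint_family_on (\<lambda>cs. E cs \<inter> {\<omega> \<in> space M. Q \<omega>}) S"
      by (auto simp: disjoint_family_on_def E_def)
    moreover have "(\<lambda>cs. E cs \<inter> {\<omega> \<in> space M. Q \<omega>}) ` S \<subseteq> sets M"
      using E_sets by auto
    ultimately show ?thesis
      using finite_measure_finite_Union[OF \<open>finite S\<close>] by metis
  qed
  have step: "prob (E cs \<inter> {\<omega> \<in> space M. D n \<omega> = c}) = prob (E cs) *
    ((if c = White then real \<alpha> + real m * real k
     else real \<beta> + real m * (real n - real k)) / (real \<alpha> + real \<beta> + real m * real n))"
    if "cs \<in> S" for cs
  proof (cases "prob (E cs) = 0")
    case True
    have "prob (E cs \<inter> {\<omega> \<in> space M. D n \<omega> = c}) \<le> prob (E cs)"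
      by (intro finite_measure_mono E_sets) auto
    with True show ?thesis by (simp add: measure_le_0_iff)
  next
    case False
    have "\<P>(\<omega> in M. D n \<omega> = c \<bar> map (\<lambda>i. D i \<omega>) [0..<n] = cs) = pmf (pmf_of_multiset (urn \<alpha> \<beta> m cs)) c"
      using urn that False unfolding polya_urn_def E_def S_def by blast
    then have "\<P>(\<omega> in M. D n \<omega> = c \<and> map (\<lambda>i. D i \<omega>) [0..<n] = cs) = prob (E cs) * pmf (pmf_of_multiset (urn \<alpha> \<beta> m cs)) c"
      using False by (simp add: cond_prob_def E_def field_simps)
    moreover have "{\<omega> \<in> space M. D n \<omega> = c \<and> map (\<lambda>i. D i \<omega>) [0..<n] = cs} = E cs \<inter> {\<omega> \<in> space M. D n \<omega> = c}"
      by (auto simp: E_def)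
    ultimately show ?thesis
      using that by (simp add: pmf_urn[OF \<open>\<alpha> \<ge> 1\<close>] S_def)
  qed
  have "\<P>(\<omega> in M. white_draws D n \<omega> = k \<and> D n \<omega> = c) = (\<Sum>cs\<in>S. prob (E cs \<inter> {\<omega> \<in> space M. D n \<omega> = c}))"
    by (rule split) measurable
  also have "\<dots> = (\<Sum>cs\<in>S. prob (E cs)) * ((if c = White then real \<alpha> + real m * real k
     else real \<beta> + real m * (real n - real k)) / (real \<alpha> + real \<beta> + real m * real n))"
    by (simp add: step sum_distrib_right del: times_divide_eq_right)
  also have "(\<Sum>cs\<in>S. prob (E cs)) = \<P>(\<omega> in M. white_draws D n \<omega> = k)"
  proof -
    have "E cs \<inter> space M = E cs" for cs by (auto simp: E_def)
    then show ?thesis using split[of "\<lambda>_. True"] by simp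
  qed
  finally show ?thesis .
qed

lemma measurable_white_draws:
  assumes "polya_urn M \<alpha> \<beta> m D"
  shows "white_draws D n \<in> measurable M (count_space UNIV)"
proof -
  have D[measurable]: "D i \<in> measurable M (count_space UNIV)" for i
    using assms by (auto simp: polya_urn_def)
  have "white_draws D n = (\<lambda>\<omega>. \<Sum>i<n. if D i \<omega> = White then 1 else 0)"
  proof
    fix \<omega>
    have "{i. i < n \<and> D i \<omega> = White} = {i \<in> {..<n}. D i \<omega> = White}" by auto
    then show "white_draws D n \<omega> = (\<Sum>i<n. if D i \<omega> = White then 1 else 0)"
      by (simp add: white_draws_def sum.If_cases Int_def)
  qed
  also have "\<dots> \<in> measurable M (count_space UNIV)" by measurable
  finally show ?thesis .
qed

lemma white_draws_Suc:
  "white_draws D (Suc n) \<omega> = (if D n \<omega> = White then Suc (white_draws D n \<omega>) else white_draws D n \<omega>)"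
proof -
  have "{i. i < Suc n \<and> D i \<omega> = White} =
    (if D n \<omega> = White then insert n {i. i < n \<and> D i \<omega> = White} else {i. i < n \<and> D i \<omega> = White})"
    by (auto simp: less_Suc_eq)
  then show ?thesis by (simp add: white_draws_def)
qed

lemma white_draws_le: "white_draws D n \<omega> \<le> n"
  using card_mono[of "{..<n}" "{i. i < n \<and> D i \<omega> = White}"] by (auto simp: white_draws_def)

text \<open>
  Dividing numerator and denominator of the drawing probabilities by \<open>m\<close> leaves only the ratios
  \<open>a = \<alpha> / m\<close> and \<open>b = \<beta> / m\<close>, which are the parameters of the limiting beta distribution.
\<close>

lemma white_draws_law_Suc:
  assumes M: "prob_space M" and urn: "polya_urn M \<alpha> \<beta> m D" and "\<alpha> \<ge> 1" "m \<ge> 1"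
  defines "a \<equiv> real \<alpha> / real m" and "b \<equiv> real \<beta> / real m"
  defines "p \<equiv> \<lambda>n k. \<P>(\<omega> in M. white_draws D n \<omega> = k)"
  shows "p (Suc n) 0 * (a + b + n) = p n 0 * (b + n)"
    and "p (Suc n) (Suc k) * (a + b + n) = p n (Suc k) * (b + n - Suc k) + p n k * (a + k)"
proof -
  interpret prob_space M by fact
  have D[measurable]: "D i \<in> measurable M (count_space UNIV)" for i
    using urn by (auto simp: polya_urn_def)
  note [measurable] = measurable_white_draws[OF urn]
  have scale: "(real \<alpha> + real m * real k) / (real \<alpha> + real \<beta> + real m * real n) = (a + k) / (a + b + n)"
    "(real \<beta> + real m * (real n - real k)) / (real \<alpha> + real \<beta> + real m * real n) = (b + n - k) / (a + b + n)" for k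
  proof -
    have "real \<alpha> = m * a" "real \<beta> = m * b" using \<open>m \<ge> 1\<close> by (auto simp: a_def b_def)
    then have "real \<alpha> + real m * real k = m * (a + k)"
      "real \<beta> + real m * (real n - real k) = m * (b + n - k)"
      "real \<alpha> + real \<beta> + real m * real n = m * (a + b + n)" by (auto simp: algebra_simps)
    then show "(real \<alpha> + real m * real k) / (real \<alpha> + real \<beta> + real m * real n) = (a + k) / (a + b + n)"
    "(real \<beta> + real m * (real n - real k)) / (real \<alpha> + real \<beta> + real m * real n) = (b + n - k) / (a + b + n)"
      using \<open>m \<ge> 1\<close> by auto
  qed
  have pos: "a + b + n > 0" using assms by (auto simp: a_def b_def intro!: add_pos_nonneg)
  have W: "\<P>(\<omega> in M. white_draws D n \<omega> = k \<and> D n \<omega> = White) * (a + b + n) = p n k * (a + k)" for k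
    using prob_white_draws_and_colour[OF M urn \<open>\<alpha> \<ge> 1\<close>, of n k White] pos
    by (simp add: scale p_def del: times_divide_eq_right)
  have B: "\<P>(\<omega> in M. white_draws D n \<omega> = k \<and> D n \<omega> = Black) * (a + b + n) = p n k * (b + n - k)" for k
    using prob_white_draws_and_colour[OF M urn \<open>\<alpha> \<ge> 1\<close>, of n k Black] pos
    by (simp add: scale p_def del: times_divide_eq_right)
  have colour: "D n \<omega> \<noteq> White \<longleftrightarrow> D n \<omega> = Black" for \<omega> by (cases "D n \<omega>") auto
  have "p (Suc n) 0 = \<P>(\<omega> in M. white_draws D n \<omega> = 0 \<and> D n \<omega> = Black)"
    unfolding p_def by (rule arg_cong[where f = prob]) (auto simp: white_draws_Suc colour[symmetric])
  then show "p (Suc n) 0 * (a + b + n) = p n 0 * (b + n)" using B[of 0] by simp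
  have "{\<omega> \<in> space M. white_draws D (Suc n) \<omega> = Suc k} =
    {\<omega> \<in> space M. white_draws D n \<omega> = Suc k \<and> D n \<omega> = Black} \<union>
    {\<omega> \<in> space M. white_draws D n \<omega> = k \<and> D n \<omega> = White}"
    by (auto simp: white_draws_Suc colour[symmetric])
  moreover have "prob ({\<omega> \<in> space M. white_draws D n \<omega> = Suc k \<and> D n \<omega> = Black} \<union>
    {\<omega> \<in> space M. white_draws D n \<omega> = k \<and> D n \<omega> = White}) =
    prob {\<omega> \<in> space M. white_draws D n \<omega> = Suc k \<and> D n \<omega> = Black} +
    prob {\<omega> \<in> space M. white_draws D n \<omega> = k \<and> D n \<omega> = White}"
    by (rule finite_measure_Union) (measurable, auto)
  ultimately have "p (Suc n) (Suc k) = \<P>(\<omega> in M. white_draws D n \<omega> = Suc k \<and> D n \<omega> = Black)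
    + \<P>(\<omega> in M. white_draws D n \<omega> = k \<and> D n \<omega> = White)"
    by (simp add: p_def)
  then show "p (Suc n) (Suc k) * (a + b + n) = p n (Suc k) * (b + n - Suc k) + p n k * (a + k)"
    using W[of k] B[of "Suc k"] by (simp add: distrib_right)
qed

text \<open>
  Up to normalisation the recursion determines the beta-binomial law, and this is the ratio of its
  consecutive probabilities.
  Induction on \<open>n\<close> gives the ratio without the closed formula: by the induction hypothesis both
  \<open>(k + 1) p (n + 1) (k + 1)\<close> and \<open>(n + 1 - k) p (n + 1) k\<close> are explicit multiples of \<open>p n k\<close>.
\<close>

lemma ratio_from_urn_recursion:
  fixes p :: "nat \<Rightarrow> nat \<Rightarrow> real" and a b :: real
  assumes "a > 0" "b > 0"
    and p_0: "\<And>k. k > 0 \<Longrightarrow> p 0 k = 0"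
    and p_Suc_0: "\<And>n. p (Suc n) 0 * (a + b + n) = p n 0 * (b + n)"
    and p_Suc_Suc: "\<And>n k. p (Suc n) (Suc k) * (a + b + n) = p n (Suc k) * (b + n - Suc k) + p n k * (a + k)"
  shows "Suc k * (b + n - Suc k) * p n (Suc k) = (real n - k) * (a + k) * p n k"
proof (induction n arbitrary: k)
  case 0
  show ?case using p_0[of k] p_0[of "Suc k"] by (cases "k = 0") auto
next
  case (Suc n)
  have pos: "a + b + n > 0" using assms by auto
  have 1: "Suc k * (p (Suc n) (Suc k) * (a + b + n)) = (n + 1) * (a + k) * p n k"
    using Suc.IH[of k] unfolding p_Suc_Suc by (simp add: algebra_simps)
  have 2: "(n + 1 - real k) * (p (Suc n) k * (a + b + n)) = (n + 1) * (b + n - k) * p n k"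
  proof (cases k)
    case 0
    then show ?thesis using p_Suc_0[of n] by simp
  next
    case (Suc j)
    have "(n + 1 - real k) * (p (Suc n) k * (a + b + n)) =
      (n + 1 - real k) * (b + n - k) * p n k + (real n - j) * (a + j) * p n j"
      unfolding Suc p_Suc_Suc by (simp add: algebra_simps)
    also have "(real n - j) * (a + j) * p n j = k * (b + n - k) * p n k"
      using Suc.IH[of j] Suc by simp
    finally show ?thesis by (simp add: algebra_simps)
  qed
  have "(Suc k * (b + Suc n - Suc k) * p (Suc n) (Suc k)) * (a + b + n) =
     ((real (Suc n) - k) * (a + k) * p (Suc n) k) * (a + b + n)"
  proof -
    have "(Suc k * (b + Suc n - Suc k) * p (Suc n) (Suc k)) * (a + b + n) =
      (b + n - k) * (Suc k * (p (Suc n) (Suc k) * (a + b + n)))" by simp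
    also have "\<dots> = (a + k) * ((n + 1 - real k) * (p (Suc n) k * (a + b + n)))"
      unfolding 1 2 by simp
    also have "\<dots> = ((real (Suc n) - k) * (a + k) * p (Suc n) k) * (a + b + n)"
      by (simp add: add.commute)
    finally show ?thesis .
  qed
  then show ?case using pos by simp
qed

text \<open>
  The discrete Stein identity. By the ratio of consecutive probabilities the two sums agree after a
  shift of the index; no boundary terms remain because of the factors \<open>k\<close> and \<open>n - k\<close>.
\<close>

lemma sum_characterisation:
  fixes p g :: "nat \<Rightarrow> real" and a b :: real
  assumes ratio: "\<And>k. Suc k * (b + n - Suc k) * p (Suc k) = (real n - k) * (a + k) * p k"
  shows "(\<Sum>k\<le>n. p k * (k * (b + n - k) * g k)) = (\<Sum>k\<le>n. p k * ((real n - k) * (a + k) * g (Suc k)))"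
proof -
  have "(\<Sum>k\<le>n. p k * (k * (b + n - k) * g k)) = (\<Sum>k<n. p (Suc k) * (Suc k * (b + n - Suc k) * g (Suc k)))"
    by (simp add: lessThan_Suc_atMost[symmetric] sum.lessThan_Suc_shift del: sum.lessThan_Suc)
  also have "\<dots> = (\<Sum>k<n. p k * ((real n - k) * (a + k) * g (Suc k)))"
  proof (intro sum.cong refl)
    fix k
    have "p (Suc k) * (Suc k * (b + n - Suc k) * g (Suc k)) = (Suc k * (b + n - Suc k) * p (Suc k)) * g (Suc k)"
      by simp
    also have "\<dots> = p k * ((real n - k) * (a + k) * g (Suc k))"
      unfolding ratio by simp
    finally show "p (Suc k) * (Suc k * (b + n - Suc k) * g (Suc k)) = p k * ((real n - k) * (a + k) * g (Suc k))" .
  qed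
  also have "\<dots> = (\<Sum>k\<le>n. p k * ((real n - k) * (a + k) * g (Suc k)))"
    by (simp add: lessThan_Suc_atMost[symmetric])
  finally show ?thesis .
qed

lemma expectation_white_draws:
  assumes "prob_space M" "polya_urn M \<alpha> \<beta> m D"
  shows "(\<integral>\<omega>. h (real (white_draws D n \<omega>) / n) \<partial>M) = (\<Sum>k\<le>n. \<P>(\<omega> in M. white_draws D n \<omega> = k) * h (real k / n))"
proof -
  interpret prob_space M by fact
  note [measurable] = measurable_white_draws[OF assms(2)]
  have "(\<integral>\<omega>. h (real (white_draws D n \<omega>) / n) \<partial>M) =
      (\<integral>\<omega>. (\<Sum>k\<le>n. indicator {\<omega> \<in> space M. white_draws D n \<omega> = k} \<omega> * h (real k / n)) \<partial>M)"
  proof (rule Bochner_Integration.integral_cong[OF refl])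
    fix \<omega> assume "\<omega> \<in> space M"
    then have "(\<Sum>k\<le>n. indicator {\<omega> \<in> space M. white_draws D n \<omega> = k} \<omega> * h (real k / n)) =
       (\<Sum>k\<le>n. if k = white_draws D n \<omega> then h (real k / n) else 0)"
      by (intro sum.cong) (auto simp: indicator_def)
    then show "h (real (white_draws D n \<omega>) / n) = (\<Sum>k\<le>n. indicator {\<omega> \<in> space M. white_draws D n \<omega> = k} \<omega> * h (real k / n))"
      by (simp add: white_draws_le)
  qed
  also have "\<dots> = (\<Sum>k\<le>n. \<integral>\<omega>. indicator {\<omega> \<in> space M. white_draws D n \<omega> = k} \<omega> * h (real k / n) \<partial>M)"
    by (intro Bochner_Integration.integral_sum integrable_mult_left integrable_real_indicator)
      (auto simp: less_top[symmetric])
  also have "\<dots> = (\<Sum>k\<le>n. \<P>(\<omega> in M. white_draws D n \<omega> = k) * h (real k / n))"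
    by simp
  finally show ?thesis .
qed

section \<open>Comparing functions through their derivatives\<close>

lemma increment_le_by_derivative:
  fixes \<phi> H :: "real \<Rightarrow> real"
  assumes "c \<le> d" "continuous_on {c..d} \<phi>" "continuous_on {c..d} H"
    and "\<And>x. c < x \<Longrightarrow> x < d \<Longrightarrow> (\<phi> has_real_derivative \<phi>' x) (at x)"
    and "\<And>x. c < x \<Longrightarrow> x < d \<Longrightarrow> (H has_real_derivative H' x) (at x)"
    and "\<And>x. c < x \<Longrightarrow> x < d \<Longrightarrow> \<phi>' x \<le> H' x"
  shows "\<phi> d - \<phi> c \<le> H d - H c"
proof (cases "c = d")
  case False
  let ?F = "\<lambda>x. H x - \<phi> x"
  have F: "(?F has_real_derivative H' x - \<phi>' x) (at x)" if "c < x" "x < d" for x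
    using assms that by (auto intro!: derivative_eq_intros)
  obtain l z where "c < z" "z < d" "(?F has_real_derivative l) (at z)" "?F d - ?F c = (d - c) * l"
    using MVT[of c d ?F] assms False F by (force intro!: continuous_intros simp: real_differentiable_def)
  moreover from this F[of z] have "l = H' z - \<phi>' z" by (blast intro: DERIV_unique)
  ultimately have "0 \<le> ?F d - ?F c" using assms by simp
  then show ?thesis by simp
qed simp

lemma abs_increment_le_by_derivative:
  fixes \<phi> H :: "real \<Rightarrow> real"
  assumes "c \<le> d" "continuous_on {c..d} \<phi>" "continuous_on {c..d} H"
    and "\<And>x. c < x \<Longrightarrow> x < d \<Longrightarrow> (\<phi> has_real_derivative \<phi>' x) (at x)"
    and "\<And>x. c < x \<Longrightarrow> x < d \<Longrightarrow> (H has_real_derivative H' x) (at x)"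
    and "\<And>x. c < x \<Longrightarrow> x < d \<Longrightarrow> \<bar>\<phi>' x\<bar> \<le> H' x"
  shows "\<bar>\<phi> d - \<phi> c\<bar> \<le> H d - H c"
proof -
  have "\<phi> d - \<phi> c \<le> H d - H c"
    by (rule increment_le_by_derivative[where \<phi>' = \<phi>' and H' = H']) (use assms in \<open>auto simp: abs_le_iff\<close>)
  moreover have "(- \<phi> d) - (- \<phi> c) \<le> H d - H c"
    by (rule increment_le_by_derivative[where \<phi>' = "\<lambda>x. - \<phi>' x" and H' = H'])
      (use assms in \<open>auto simp: abs_le_iff intro!: continuous_intros derivative_intros\<close>)
  ultimately show ?thesis by linarith
qed

lemma abs_diff_le_by_derivative:
  fixes h :: "real \<Rightarrow> real"
  assumes "x \<le> y" "continuous_on {x..y} h"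
    and "\<And>u. x < u \<Longrightarrow> u < y \<Longrightarrow> (h has_real_derivative h' u) (at u)"
    and "\<And>u. x < u \<Longrightarrow> u < y \<Longrightarrow> \<bar>h' u\<bar> \<le> L"
  shows "\<bar>h y - h x\<bar> \<le> L * (y - x)"
proof -
  have "\<bar>h y - h x\<bar> \<le> L * y - L * x"
    by (rule abs_increment_le_by_derivative[where \<phi>' = h' and H = "\<lambda>u. L * u" and H' = "\<lambda>_. L"])
      (use assms in \<open>auto intro!: continuous_intros derivative_eq_intros\<close>)
  then show ?thesis by (simp add: right_diff_distrib)
qed

section \<open>Primitives of functions dominated by the beta weight\<close>

text \<open>
  The function \<open>exp (- t) (1 + t + t\<^sup>2 / 2 + 3/10 t\<^sup>3)\<close> is 1 at 0 and has the derivative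
  \<open>exp (- t) t\<^sup>2 (4/10 - 3/10 t)\<close>, which is nonnegative exactly up to \<open>4/3\<close>.
\<close>

lemma exp_le_cubic:
  fixes t :: real
  assumes "0 \<le> t" "t \<le> 4/3"
  shows "exp t \<le> 1 + t + t\<^sup>2 / 2 + 3/10 * t^3"
proof -
  let ?D = "\<lambda>t::real. exp (- t) * (1 + t + t\<^sup>2 / 2 + 3/10 * t^3)"
  have "1 - 1 \<le> ?D t - ?D 0"
  proof (rule increment_le_by_derivative[where c = 0 and d = t and H = ?D and \<phi> = "\<lambda>_. 1" and \<phi>' = "\<lambda>_. 0" and H' = "\<lambda>t. exp (- t) * (t\<^sup>2 * (4/10 - 3/10 * t))"])
    fix x :: real assume x: "0 < x" "x < t"
    show "(?D has_real_derivative exp (- x) * (x\<^sup>2 * (4/10 - 3/10 * x))) (at x)"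
      by (auto intro!: derivative_eq_intros simp: field_simps power2_eq_square power3_eq_cube)
    show "0 \<le> exp (- x) * (x\<^sup>2 * (4/10 - 3/10 * x))" using x assms by auto
  qed (use assms in \<open>auto intro!: continuous_intros\<close>)
  then show ?thesis by (simp add: exp_minus field_simps)
qed

text \<open>
  This polynomial inequality is where the constant 3 for the tails of the beta distribution, and so
  the bound 6 on \<open>f'\<close>, comes from.
\<close>

lemma tail_constant_le_3:
  fixes \<rho> :: real
  assumes "0 \<le> \<rho>" "\<rho> \<le> 1"
  defines "d \<equiv> 4/3 - 2/3 * \<rho>"
  shows "(1 + \<rho>) * (1 + d / 2 + 3/10 * d\<^sup>2) \<le> 3"
proof -
  have "\<rho> ^ 3 \<le> \<rho> ^ 2" using assms by (intro power_decreasing) auto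
  moreover have "3/5 * \<rho>\<^sup>2 \<ge> 4/3 * \<rho> - 11/15"
    using mult_nonneg_nonneg[of "1 - \<rho>" "11 - 9 * \<rho>"] assms by (simp add: algebra_simps power2_eq_square)
  moreover have "(1 + \<rho>) * (1 + d / 2 + 3/10 * d\<^sup>2) = 11/5 + 4/3 * \<rho> - 11/15 * \<rho>\<^sup>2 + 2/15 * \<rho>^3"
    by (simp add: d_def field_simps power2_eq_square power3_eq_cube)
  ultimately show ?thesis by simp
qed

text \<open>
  The tangent inequality \<open>ln y \<le> y - 1\<close>, applied to \<open>u / x\<close> and to \<open>(1 - u) / (1 - x)\<close>, dominates the
  beta weight to the left of \<open>x\<close> by an exponential function of \<open>u\<close>.
\<close>

lemma beta_weight_le_exp:
  fixes a b u x d :: real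
  assumes "0 \<le> a" "0 \<le> b" "0 < u" "u \<le> x" "x < 1" and d: "b * (x / (1 - x)) - a \<le> d"
  shows "u powr a * (1 - u) powr b \<le> x powr a * (1 - x) powr b * exp (d * (1 - u / x))"
proof -
  have "a * (ln u - ln x) \<le> a * (u / x - 1)"
    using assms ln_le_minus_one[of "u / x"] by (intro mult_left_mono) (auto simp: ln_div)
  moreover have "b * (ln (1 - u) - ln (1 - x)) \<le> b * ((1 - u) / (1 - x) - 1)"
    using assms ln_le_minus_one[of "(1 - u) / (1 - x)"] by (intro mult_left_mono) (auto simp: ln_div)
  moreover have "a * (u / x - 1) + b * ((1 - u) / (1 - x) - 1) = (b * (x / (1 - x)) - a) * (1 - u / x)"
    using assms by (simp add: field_simps)
  moreover have "\<dots> \<le> d * (1 - u / x)"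
    using assms by (intro mult_right_mono) auto
  ultimately have "a * ln u + b * ln (1 - u) \<le> a * ln x + b * ln (1 - x) + d * (1 - u / x)"
    by (simp add: algebra_simps)
  then show ?thesis
    using assms by (simp add: powr_def flip: exp_add)
qed

lemma beta_weight_derivative:
  fixes a b x :: real
  assumes "0 < x" "x < 1"
  shows "((\<lambda>x. x powr a * (1 - x) powr b) has_real_derivative
    (a - (a + b) * x) * (x powr (a - 1) * (1 - x) powr (b - 1))) (at x)"
proof -
  have base: "x powr a = x * x powr (a - 1)" "(1 - x) powr b = (1 - x) * (1 - x) powr (b - 1)"
    using assms by (simp_all add: powr_mult_base)
  have "((\<lambda>x. x powr a * (1 - x) powr b) has_real_derivative
      a * x powr (a - 1) * (1 - x) powr b + x powr a * (- b * (1 - x) powr (b - 1))) (at x)"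
    using assms by (auto intro!: derivative_eq_intros)
  also have "a * x powr (a - 1) * (1 - x) powr b + x powr a * (- b * (1 - x) powr (b - 1)) =
      (a - (a + b) * x) * (x powr (a - 1) * (1 - x) powr (b - 1))"
    unfolding base by (simp add: algebra_simps)
  finally show ?thesis .
qed

lemma continuous_on_beta_weight:
  fixes a b :: real
  assumes "a > 0" "b > 0"
  shows "continuous_on {0..1} (\<lambda>x. x powr a * (1 - x) powr b)"
  using assms by (intro continuous_intros continuous_on_powr') auto

text \<open>
  The derivative of \<open>x\<^bsup>a + 1\<^esup> (1 - x)\<^bsup>b + 1\<^esup>\<close> is \<open>(a + 1 - (a + b + 2) x) x\<^bsup>a\<^esup> (1 - x)\<^bsup>b\<^esup>\<close>. To the left of
  a point where the linear factor is still at least \<open>1/3\<close>, six times this dominates \<open>g'\<close>.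
\<close>

lemma primitive_bound_far_left:
  fixes a b x :: real
  assumes "a > 0" "b > 0" "0 < x" "x < 1"
    and "continuous_on {0..x} g" "g 0 = 0"
    and g': "\<And>u. 0 < u \<Longrightarrow> u < x \<Longrightarrow> (g has_real_derivative g' u) (at u)"
    and bound: "\<And>u. 0 < u \<Longrightarrow> u < x \<Longrightarrow> \<bar>g' u\<bar> \<le> 2 * (u powr a * (1 - u) powr b)"
    and far: "(a + b + 2) * x \<le> a + 2/3"
  shows "\<bar>g x\<bar> \<le> 6 * (x powr (a + 1) * (1 - x) powr (b + 1))"
proof -
  let ?H = "\<lambda>x. 6 * (x powr (a + 1) * (1 - x) powr (b + 1))"
  have "\<bar>g x - g 0\<bar> \<le> ?H x - ?H 0"
  proof (rule abs_increment_le_by_derivative[where \<phi>' = g' and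
        H' = "\<lambda>u. 6 * ((a + 1 - (a + b + 2) * u) * (u powr a * (1 - u) powr b))"])
    show "continuous_on {0..x} ?H"
      by (intro continuous_on_mult_left continuous_on_subset[OF continuous_on_beta_weight]) (use assms in auto)
    fix u assume u: "0 < u" "u < x"
    show "(?H has_real_derivative 6 * ((a + 1 - (a + b + 2) * u) * (u powr a * (1 - u) powr b))) (at u)"
      using DERIV_cmult[OF beta_weight_derivative[of u "a + 1" "b + 1"], of 6] u assms by (simp add: algebra_simps)
    have "(a + b + 2) * u \<le> (a + b + 2) * x" using assms u by (intro mult_left_mono) auto
    then have "1 / 3 * (u powr a * (1 - u) powr b) \<le> (a + 1 - (a + b + 2) * u) * (u powr a * (1 - u) powr b)"
      using far by (intro mult_right_mono) auto
    then show "\<bar>g' u\<bar> \<le> 6 * ((a + 1 - (a + b + 2) * u) * (u powr a * (1 - u) powr b))"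
      using bound[OF u] by linarith
  qed (use assms in auto)
  with assms show ?thesis by simp
qed

text \<open>
  Close to the mean \<open>(a + 1) / (a + b + 2)\<close> the linear factor of the previous proof becomes small or
  negative. Here \<open>x\<^bsup>a\<^esup> (1 - x)\<^bsup>b\<^esup>\<close> is dominated by an exponential instead, which is integrated in closed
  form. The restriction \<open>x \<le> 1/2\<close> keeps the factor \<open>1 / (1 - x)\<close> that this costs bounded by 2.
\<close>

lemma primitive_bound_near_left:
  fixes a b x :: real
  assumes "a > 0" "b > 0" "0 < x" "x \<le> 1/2"
    and "continuous_on {0..x} g" "g 0 = 0"
    and g': "\<And>u. 0 < u \<Longrightarrow> u < x \<Longrightarrow> (g has_real_derivative g' u) (at u)"
    and bound: "\<And>u. 0 < u \<Longrightarrow> u < x \<Longrightarrow> \<bar>g' u\<bar> \<le> 2 * (u powr a * (1 - u) powr b)"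
    and near: "(a + b + 2) * x \<le> a + 4/3"
  shows "\<bar>g x\<bar> \<le> 6 * (x powr (a + 1) * (1 - x) powr (b + 1))"
proof -
  \<comment> \<open>The rate \<open>d\<close> is the largest value that the rate \<open>b \<rho> - a\<close> of the exponential can take under the
    assumption on \<open>x\<close>; it lies between \<open>2/3\<close> and \<open>4/3\<close>, where the cubic bound on \<open>exp d\<close> applies.\<close>
  define \<rho> where "\<rho> = x / (1 - x)"
  define d where "d = 4/3 - 2/3 * \<rho>"
  define R where "R = x powr a * (1 - x) powr b"
  have \<rho>: "0 \<le> \<rho>" "\<rho> \<le> 1" "1 + \<rho> = 1 / (1 - x)" using assms by (auto simp: \<rho>_def field_simps)
  have d: "0 < d" "d \<le> 4/3" using \<rho> by (auto simp: d_def)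
  have rate: "b * \<rho> - a \<le> d"
  proof -
    have "(b + 2/3) * x \<le> (a + 4/3) * (1 - x)" using near by (simp add: field_simps)
    then have "(b + 2/3) * \<rho> \<le> a + 4/3" using assms by (simp add: \<rho>_def pos_divide_le_eq)
    then show ?thesis by (simp add: d_def algebra_simps)
  qed
  let ?H = "\<lambda>u. 2 * R * (x / d) * (exp d - exp (d * (1 - u / x)))"
  have "\<bar>g x - g 0\<bar> \<le> ?H x - ?H 0"
  proof (rule abs_increment_le_by_derivative[where \<phi>' = g' and H' = "\<lambda>u. 2 * (R * exp (d * (1 - u / x)))"])
    fix u assume u: "0 < u" "u < x"
    show "(?H has_real_derivative 2 * (R * exp (d * (1 - u / x)))) (at u)"
      using d assms by (auto intro!: derivative_eq_intros)
    have "u powr a * (1 - u) powr b \<le> R * exp (d * (1 - u / x))"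
      unfolding R_def by (rule beta_weight_le_exp) (use assms u rate \<rho>_def in auto)
    then show "\<bar>g' u\<bar> \<le> 2 * (R * exp (d * (1 - u / x)))"
      using bound[OF u] by linarith
  qed (use assms d in \<open>auto intro!: continuous_intros\<close>)
  then have "\<bar>g x\<bar> \<le> 2 * R * x * ((exp d - 1) / d)"
    using assms by simp
  also have "(exp d - 1) / d \<le> 1 + d / 2 + 3/10 * d\<^sup>2"
    using exp_le_cubic[of d] d by (simp add: field_simps power2_eq_square power3_eq_cube)
  also have "\<dots> \<le> 3 * (1 - x)"
    using tail_constant_le_3[of \<rho>] \<rho> assms unfolding d_def[symmetric] by (simp add: field_simps)
  also have "2 * R * x * (3 * (1 - x)) = 6 * (x powr (a + 1) * (1 - x) powr (b + 1))"
    using assms by (simp add: R_def powr_add)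
  finally show ?thesis
    using assms by (simp add: R_def mult_left_mono)
qed

text \<open>
  A primitive that vanishes at both ends is controlled by the tail of its derivative on either side,
  and one of the two sides is always good: the left one if \<open>x\<close> is well below the mean
  \<open>(a + 1) / (a + b + 2)\<close>, or near it and at most \<open>1/2\<close>; otherwise the right one. The right side is the
  left side for the reflected function \<open>u \<mapsto> g (1 - u)\<close> with \<open>a\<close> and \<open>b\<close> exchanged.
\<close>

lemma primitive_bound:
  fixes a b x :: real
  assumes ab: "a > 0" "b > 0" and x: "0 < x" "x < 1"
    and cont: "continuous_on {0..1} g" and zero: "g 0 = 0" "g 1 = 0"
    and g': "\<And>u. 0 < u \<Longrightarrow> u < 1 \<Longrightarrow> (g has_real_derivative g' u) (at u)"
    and bound: "\<And>u. 0 < u \<Longrightarrow> u < 1 \<Longrightarrow> \<bar>g' u\<bar> \<le> 2 * (u powr a * (1 - u) powr b)"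
  shows "\<bar>g x\<bar> \<le> 6 * (x powr (a + 1) * (1 - x) powr (b + 1))"
proof -
  let ?g = "\<lambda>u. g (1 - u)"
  have cont_left: "continuous_on {0..x} g"
    by (rule continuous_on_subset[OF cont]) (use x in auto)
  have cont_right: "continuous_on {0..1 - x} ?g"
    by (rule continuous_on_compose2[OF cont]) (use x in \<open>auto intro!: continuous_intros\<close>)
  have deriv_right: "(?g has_real_derivative - g' (1 - u)) (at u)" if "0 < u" "u < 1 - x" for u
  proof -
    have "((\<lambda>u. 1 - u) has_real_derivative -1) (at u)"
      by (auto intro!: derivative_eq_intros)
    moreover have "(g has_real_derivative g' (1 - u)) (at (1 - u))"
      using g'[of "1 - u"] that x by simp
    ultimately show ?thesis
      using DERIV_chain2[where f = g and g = "\<lambda>u. 1 - u" and x = u and Db = "-1" and Da = "g' (1 - u)"] by simp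
  qed
  have bound_right: "\<bar>- g' (1 - u)\<bar> \<le> 2 * (u powr b * (1 - u) powr a)" if "0 < u" "u < 1 - x" for u
    using bound[of "1 - u"] that x by (simp add: mult.commute)
  have mirror: "6 * ((1 - x) powr (b + 1) * (1 - (1 - x)) powr (a + 1)) = 6 * (x powr (a + 1) * (1 - x) powr (b + 1))"
    by simp
  \<comment> \<open>The two thresholds lie at distance \<open>1/3\<close> on either side of the equation \<open>(a + b + 2) x = a + 1\<close>
    of the mean.\<close>
  consider "(a + b + 2) * x \<le> a + 2/3" | "(a + b + 2) * x \<ge> a + 4/3"
    | "(a + b + 2) * x \<le> a + 4/3" "x \<le> 1/2" | "(a + b + 2) * x \<ge> a + 2/3" "x \<ge> 1/2"
    by linarith
  then show ?thesis
  proof cases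
    case 1
    show ?thesis
      by (rule primitive_bound_far_left[OF ab x cont_left zero(1), of g']) (use g' bound x 1 in auto)
  next
    case 2
    have "\<bar>?g (1 - x)\<bar> \<le> 6 * ((1 - x) powr (b + 1) * (1 - (1 - x)) powr (a + 1))"
      by (rule primitive_bound_far_left[OF ab(2,1) _ _ cont_right _ deriv_right bound_right])
        (use x zero 2 in \<open>auto simp: algebra_simps\<close>)
    then show ?thesis unfolding mirror by simp
  next
    case 3
    show ?thesis
      by (rule primitive_bound_near_left[OF ab x(1) 3(2) cont_left zero(1), of g']) (use g' bound x 3 in auto)
  next
    case 4
    have "\<bar>?g (1 - x)\<bar> \<le> 6 * ((1 - x) powr (b + 1) * (1 - (1 - x)) powr (a + 1))"
      by (rule primitive_bound_near_left[OF ab(2,1) _ _ cont_right _ deriv_right bound_right])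
        (use x zero 4 in \<open>auto simp: algebra_simps\<close>)
    then show ?thesis unfolding mirror by simp
  qed
qed

text \<open>
  The function increases from 0 as long as \<open>\<phi>\<close> is nonnegative and decreases to 0 afterwards.
\<close>

lemma nonneg_if_derivative_changes_sign_once:
  fixes \<Phi> :: "real \<Rightarrow> real"
  assumes "continuous_on {0..1} \<Phi>" "\<Phi> 0 = 0" "\<Phi> 1 = 0"
    and \<Phi>': "\<And>x. 0 < x \<Longrightarrow> x < 1 \<Longrightarrow> (\<Phi> has_real_derivative \<phi> x * p x) (at x)"
    and p: "\<And>x. 0 < x \<Longrightarrow> x < 1 \<Longrightarrow> 0 \<le> p x"
    and anti: "\<And>x y. 0 < x \<Longrightarrow> x \<le> y \<Longrightarrow> y < 1 \<Longrightarrow> \<phi> y \<le> \<phi> x"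
    and x: "0 < x" "x < 1"
  shows "0 \<le> \<Phi> x"
proof (cases "0 \<le> \<phi> x")
  case True
  have "0 - 0 \<le> \<Phi> x - \<Phi> 0"
  proof (rule increment_le_by_derivative[where c = 0 and d = x and H = \<Phi> and \<phi> = "\<lambda>_. 0" and \<phi>' = "\<lambda>_. 0" and H' = "\<lambda>x. \<phi> x * p x"])
    show "continuous_on {0..x} \<Phi>"
      by (rule continuous_on_subset[OF assms(1)]) (use x in auto)
    fix u assume u: "0 < u" "u < x"
    then have "0 \<le> \<phi> u" using anti[of u x] True x by simp
    then show "0 \<le> \<phi> u * p u" using p[of u] u x by simp
  qed (use \<Phi>' x in auto)
  then show ?thesis using assms by simp
next
  case False
  have "\<Phi> 1 - \<Phi> x \<le> 0 - 0"
  proof (rule increment_le_by_derivative[where c = x and d = 1 and \<phi> = \<Phi> and H = "\<lambda>_. 0" and H' = "\<lambda>_. 0" and \<phi>' = "\<lambda>x. \<phi> x * p x"])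
    show "continuous_on {x..1} \<Phi>"
      by (rule continuous_on_subset[OF assms(1)]) (use x in auto)
    fix u assume u: "x < u" "u < 1"
    then have "\<phi> u \<le> 0" using anti[of x u] False x by simp
    then show "\<phi> u * p u \<le> 0" using p[of u] u x by (simp add: mult_nonpos_nonneg)
  qed (use \<Phi>' x in auto)
  then show ?thesis using assms by simp
qed

section \<open>Means under the beta distribution\<close>

lemma integrable_beta_weight_times:
  fixes a b :: real
  assumes "a > 0" "b > 0" "continuous_on {0..1} h"
  shows "set_integrable lborel {0..1} (\<lambda>x. h x * (x powr (a - 1) * (1 - x) powr (b - 1)))"
proof -
  obtain B where B: "\<And>x. x \<in> {0..1} \<Longrightarrow> \<bar>h x\<bar> \<le> B"
    using compact_imp_bounded[OF compact_continuous_image[OF assms(3)]] by (force simp: bounded_iff)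
  have meas: "set_borel_measurable borel {0..1} h"
    unfolding set_borel_measurable_def
    by (rule borel_measurable_continuous_on_indicator) (use assms in auto)
  have meas': "set_borel_measurable lborel {0..1} (\<lambda>x. h x * (x powr (a - 1) * (1 - x) powr (b - 1)))"
  proof -
    have "(\<lambda>x. (indicat_real {0..1} x *\<^sub>R h x) * (x powr (a - 1) * (1 - x) powr (b - 1))) \<in> borel_measurable lborel"
      using meas unfolding set_borel_measurable_def by measurable
    then show ?thesis unfolding set_borel_measurable_def by (simp add: mult.assoc)
  qed
  show ?thesis
  proof (rule set_integrable_bound[OF set_integrable_mult_right[of "\<bar>B\<bar>", OF integrable_Beta[OF assms(1,2)]] meas'])
    show "AE x in lborel. x \<in> {0..1} \<longrightarrow> norm (h x * (x powr (a - 1) * (1 - x) powr (b - 1)))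
        \<le> norm (\<bar>B\<bar> * (x powr (a - 1) * (1 - x) powr (b - 1)))"
    proof (intro AE_I2 impI)
      fix x :: real assume "x \<in> {0..1}"
      then have "\<bar>h x\<bar> * \<bar>x powr (a - 1) * (1 - x) powr (b - 1)\<bar> \<le> \<bar>B\<bar> * \<bar>x powr (a - 1) * (1 - x) powr (b - 1)\<bar>"
        using B[of x] by (intro mult_right_mono) auto
      then show "norm (h x * (x powr (a - 1) * (1 - x) powr (b - 1)))
        \<le> norm (\<bar>B\<bar> * (x powr (a - 1) * (1 - x) powr (b - 1)))"
        by (simp only: real_norm_def abs_mult abs_idempotent)
    qed
  qed
qed

text \<open>
  Kept as an ordinary integral over \<open>{0..1}\<close>, so that the mean of \<open>h\<close> makes sense without a random
  variable, in particular for the approximations of a test function.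
\<close>

definition beta_mean :: "real \<Rightarrow> real \<Rightarrow> (real \<Rightarrow> real) \<Rightarrow> real" where
  "beta_mean a b h = integral {0..1} (\<lambda>x. h x * (x powr (a - 1) * (1 - x) powr (b - 1))) / Beta a b"

lemma Beta_pos: "0 < Beta a b" if "0 < a" "0 < b" for a b :: real
  using that by (simp add: Beta_def)

lemma beta_mean_centred:
  fixes a b :: real
  assumes "a > 0" "b > 0" "continuous_on {0..1} h"
  shows "((\<lambda>x. (h x - beta_mean a b h) * (x powr (a - 1) * (1 - x) powr (b - 1))) has_integral 0) {0..1}"
proof -
  let ?p = "\<lambda>x. x powr (a - 1) * (1 - x) powr (b - 1)"
  have "((\<lambda>x. h x * ?p x) has_integral integral {0..1} (\<lambda>x. h x * ?p x)) {0..1}"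
    using set_borel_integral_eq_integral(1)[OF integrable_beta_weight_times[OF assms]]
    by (simp add: integrable_integral)
  moreover have "((\<lambda>x. beta_mean a b h * ?p x) has_integral beta_mean a b h * Beta a b) {0..1}"
    by (intro has_integral_mult_right has_integral_Beta_real assms)
  ultimately have "((\<lambda>x. h x * ?p x - beta_mean a b h * ?p x) has_integral
      integral {0..1} (\<lambda>x. h x * ?p x) - beta_mean a b h * Beta a b) {0..1}"
    by (rule has_integral_diff)
  moreover have "beta_mean a b h * Beta a b = integral {0..1} (\<lambda>x. h x * ?p x)"
    using Beta_pos[OF assms(1,2)] by (simp add: beta_mean_def)
  ultimately show ?thesis by (simp add: left_diff_distrib)
qed

lemma beta_mean_diff_le:
  fixes a b e :: real
  assumes "a > 0" "b > 0" "continuous_on {0..1} h" "continuous_on {0..1} g"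
    and close: "\<And>x. 0 \<le> x \<Longrightarrow> x \<le> 1 \<Longrightarrow> \<bar>g x - h x\<bar> \<le> e"
  shows "\<bar>beta_mean a b g - beta_mean a b h\<bar> \<le> e"
proof -
  let ?p = "\<lambda>x. x powr (a - 1) * (1 - x) powr (b - 1)"
  have mean_le: "beta_mean a b u \<le> beta_mean a b v + e"
    if "continuous_on {0..1} u" "continuous_on {0..1} v" "\<And>x. 0 \<le> x \<Longrightarrow> x \<le> 1 \<Longrightarrow> u x \<le> v x + e" for u v
  proof -
    have u: "(\<lambda>x. u x * ?p x) integrable_on {0..1}" and v: "(\<lambda>x. v x * ?p x) integrable_on {0..1}"
      using set_borel_integral_eq_integral(1) integrable_beta_weight_times[OF assms(1,2)] that(1,2) by blast+
    have e: "((\<lambda>x. e * ?p x) has_integral e * Beta a b) {0..1}"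
      by (intro has_integral_mult_right has_integral_Beta_real assms)
    have "integral {0..1} (\<lambda>x. u x * ?p x) \<le> integral {0..1} (\<lambda>x. v x * ?p x) + e * Beta a b"
    proof (rule has_integral_le[OF integrable_integral[OF u] has_integral_add[OF integrable_integral[OF v] e]])
      fix x :: real assume "x \<in> {0..1}"
      then have "u x * ?p x \<le> (v x + e) * ?p x"
        using that(3)[of x] by (intro mult_right_mono) auto
      then show "u x * ?p x \<le> v x * ?p x + e * ?p x" by (simp add: distrib_right)
    qed
    then show ?thesis
      using Beta_pos[OF assms(1,2)] by (simp add: beta_mean_def field_simps)
  qed
  have "beta_mean a b g \<le> beta_mean a b h + e"
    by (rule mean_le) (use assms(3,4) close in \<open>auto simp: abs_le_iff algebra_simps\<close>)
  moreover have "beta_mean a b h \<le> beta_mean a b g + e"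
    by (rule mean_le) (use assms(3,4) close in \<open>auto simp: abs_le_iff algebra_simps\<close>)
  ultimately show ?thesis by linarith
qed

lemma expectation_beta:
  assumes ab: "a > 0" "b > 0"
    and Z: "distributed N lborel Z (\<lambda>x. ennreal (beta_density a b x))"
    and h: "continuous_on UNIV h"
  shows "(\<integral>\<omega>. h (Z \<omega>) \<partial>N) = beta_mean a b h"
proof -
  let ?p = "\<lambda>x. x powr (a - 1) * (1 - x) powr (b - 1)"
  have h01: "continuous_on {0..1} h" using h continuous_on_subset by blast
  have density: "beta_density a b x * h x = (indicator {0..1} x *\<^sub>R (h x * ?p x)) / Beta a b" for x
    by (simp add: beta_density_def indicator_def)
  have "(\<integral>\<omega>. h (Z \<omega>) \<partial>N) = (\<integral>x. beta_density a b x * h x \<partial>lborel)"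
  proof (rule distributed_integral[OF Z, symmetric])
    show "h \<in> borel_measurable lborel" using borel_measurable_continuous_onI[OF h] by simp
    show "0 \<le> beta_density a b x" for x
      using Beta_pos[OF ab] by (simp add: beta_density_def)
  qed
  also have "\<dots> = (LINT x:{0..1}|lborel. h x * ?p x) / Beta a b"
    unfolding density set_lebesgue_integral_def by simp
  also have "(LINT x:{0..1}|lborel. h x * ?p x) = integral {0..1} (\<lambda>x. h x * ?p x)"
    by (rule set_borel_integral_eq_integral(2)[OF integrable_beta_weight_times[OF ab h01]])
  finally show ?thesis by (simp add: beta_mean_def)
qed

section \<open>The Stein equation of the beta distribution\<close>

text \<open>
  With \<open>p x = x\<^bsup>a - 1\<^esup> (1 - x)\<^bsup>b - 1\<^esup>\<close> and \<open>r x = x\<^bsup>a\<^esup> (1 - x)\<^bsup>b\<^esup>\<close>, the solution is \<open>f = K / r\<close>, where \<open>K\<close> is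
  the primitive of \<open>(h - c) p\<close>; the values at the end points are those dictated by the equation.
  Since \<open>K\<close> and \<open>r\<close> vanish at both ends, \<open>r \<plusminus> (a + b) K\<close> falls under the sign-change lemma, which
  gives the bound on \<open>f\<close>. The derivative is \<open>f' = g / (x (1 - x) r)\<close> for
  \<open>g = r (h - c) - (a - (a + b) x) K\<close>. Because \<open>r' = (a - (a + b) x) p\<close>, the terms of \<open>g'\<close> with the singular
  factor \<open>p\<close> cancel, leaving \<open>g' = r h' + (a + b) K\<close>, which is at most \<open>2 r\<close> in absolute value.
\<close>

lemma stein_equation_solution:
  fixes a b c :: real and h h' :: "real \<Rightarrow> real"
  assumes a: "a > 0" and b: "b > 0"
    and h: "continuous_on {0..1} h"
    and h': "\<And>x. 0 < x \<Longrightarrow> x < 1 \<Longrightarrow> (h has_real_derivative h' x) (at x)"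
    and lip: "\<And>x. 0 < x \<Longrightarrow> x < 1 \<Longrightarrow> \<bar>h' x\<bar> \<le> 1"
    and c: "((\<lambda>x. (h x - c) * (x powr (a - 1) * (1 - x) powr (b - 1))) has_integral 0) {0..1}"
  obtains f f' :: "real \<Rightarrow> real"
  where "continuous_on {0..1} f"
    and "\<And>x. 0 < x \<Longrightarrow> x < 1 \<Longrightarrow> (f has_real_derivative f' x) (at x)"
    and "\<And>x. 0 < x \<Longrightarrow> x < 1 \<Longrightarrow> \<bar>f' x\<bar> \<le> 6"
    and "\<And>x. 0 < x \<Longrightarrow> x < 1 \<Longrightarrow> (a + b) * \<bar>f x\<bar> \<le> 1"
    and "\<And>x. 0 \<le> x \<Longrightarrow> x \<le> 1 \<Longrightarrow> x * (1 - x) * f' x + (a - (a + b) * x) * f x = h x - c"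
proof -
  define p where "p x = x powr (a - 1) * (1 - x) powr (b - 1)" for x :: real
  define r where "r x = x powr a * (1 - x) powr b" for x :: real
  define k where "k x = h x - c" for x
  define K where "K x = integral {0..x} (\<lambda>x. k x * p x)" for x
  define g where "g x = r x * k x - (a - (a + b) * x) * K x" for x
  define f where "f x = (if x = 0 then k 0 / a else if x = 1 then - k 1 / b else K x / r x)" for x
  define f' where "f' x = g x / (x powr (a + 1) * (1 - x) powr (b + 1))" for x

  have p_pos: "p x > 0" and r_pos: "r x > 0" and r_eq: "r x = x * (1 - x) * p x" if "0 < x" "x < 1" for x
  proof -
    have base: "x powr a = x * x powr (a - 1)" "(1 - x) powr b = (1 - x) * (1 - x) powr (b - 1)"
      using that by (simp_all add: powr_mult_base)
    show "p x > 0" "r x > 0" using that by (simp_all add: p_def r_def)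
    show "r x = x * (1 - x) * p x" unfolding r_def p_def base by (simp add: mult.assoc mult.left_commute)
  qed
  have r_ends: "r 0 = 0" "r 1 = 0" by (simp_all add: r_def)
  have r_cont: "continuous_on {0..1} r"
    unfolding r_def by (rule continuous_on_beta_weight[OF a b])
  have r': "(r has_real_derivative (a - (a + b) * x) * p x) (at x)" if "0 < x" "x < 1" for x
    unfolding r_def p_def by (rule beta_weight_derivative[OF that])
  have k_cont: "continuous_on {0..1} k"
    unfolding k_def by (intro continuous_intros h)
  have k': "(k has_real_derivative h' x) (at x)" if "0 < x" "x < 1" for x
    unfolding k_def using h'[OF that] by (auto intro!: derivative_eq_intros)
  have c': "((\<lambda>x. k x * p x) has_integral 0) {0..1}"
    using c by (simp add: k_def p_def)
  then have kp: "(\<lambda>x. k x * p x) integrable_on {0..1}" by blast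
  have K_ends: "K 0 = 0" "K 1 = 0"
    using c' by (simp_all add: K_def integral_unique)
  have K_cont: "continuous_on {0..1} K"
    unfolding K_def by (rule indefinite_integral_continuous_1[OF kp])
  have K': "(K has_real_derivative k x * p x) (at x)" if "0 < x" "x < 1" for x
  proof -
    have "continuous (at x) k" using k'[OF that] by (rule DERIV_isCont)
    moreover have "continuous (at x) p"
      unfolding p_def using that by (intro continuous_intros) auto
    ultimately have "continuous (at x) (\<lambda>x. k x * p x)"
      by (rule continuous_mult)
    then have "continuous (at x within ({0..1} - {})) (\<lambda>x. k x * p x)"
      by (rule continuous_at_imp_continuous_at_within)
    then have "(K has_vector_derivative k x * p x) (at x within ({0..1} - {}))"
      unfolding K_def using that by (intro integral_has_vector_derivative_continuous_at kp) auto
    moreover have "at x within ({0..1} - {}) = at x"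
      using that by (simp add: at_within_Icc_at)
    ultimately show ?thesis
      by (simp add: has_real_derivative_iff_has_vector_derivative)
  qed

  have h_diff: "\<bar>h y - h x\<bar> \<le> y - x" if "0 < x" "x \<le> y" "y < 1" for x y
  proof -
    have "\<bar>h y - h x\<bar> \<le> 1 * (y - x)"
    proof (rule abs_diff_le_by_derivative[where h' = h'])
      show "continuous_on {x..y} h"
        by (rule continuous_on_subset[OF h]) (use that in auto)
    qed (use that h' lip in auto)
    then show ?thesis by simp
  qed
  have K_bound: "(a + b) * \<bar>K x\<bar> \<le> r x" if x: "0 < x" "x < 1" for x
  proof -
    have one_sided: "0 \<le> r x + s * ((a + b) * K x)" if s: "s = 1 \<or> s = -1" for s :: real
    proof (rule nonneg_if_derivative_changes_sign_once[where p = p and x = x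
          and \<Phi> = "\<lambda>x. r x + s * ((a + b) * K x)"
          and \<phi> = "\<lambda>x. a - (a + b) * x + s * ((a + b) * k x)"])
      show "continuous_on {0..1} (\<lambda>x. r x + s * ((a + b) * K x))"
        by (intro continuous_intros r_cont K_cont)
      fix x :: real assume x: "0 < x" "x < 1"
      show "((\<lambda>x. r x + s * ((a + b) * K x)) has_real_derivative
          (a - (a + b) * x + s * ((a + b) * k x)) * p x) (at x)"
      proof -
        have "((\<lambda>x. r x + s * ((a + b) * K x)) has_real_derivative
            (a - (a + b) * x) * p x + s * ((a + b) * (k x * p x))) (at x)"
          by (intro DERIV_add DERIV_cmult r' K' x)
        then show ?thesis by (simp add: algebra_simps)
      qed
    next
      fix x y :: real assume "0 < x" "x \<le> y" "y < 1"
      then have "s * (k y - k x) \<le> y - x"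
        using h_diff[of x y] s by (auto simp: k_def abs_le_iff)
      then have "(a + b) * (s * (k y - k x)) \<le> (a + b) * (y - x)"
        using a b by (intro mult_left_mono) auto
      then show "a - (a + b) * y + s * ((a + b) * k y) \<le> a - (a + b) * x + s * ((a + b) * k x)"
        by (simp add: algebra_simps)
    next
      fix x :: real assume "0 < x" "x < 1"
      then show "0 \<le> p x" using p_pos less_imp_le by blast
    qed (simp_all add: r_ends K_ends x)
    from one_sided[of 1] one_sided[of "-1"] show ?thesis
      using a b by (simp add: abs_if)
  qed

  have g_bound: "\<bar>g x\<bar> \<le> 6 * (x powr (a + 1) * (1 - x) powr (b + 1))" if x: "0 < x" "x < 1" for x
  proof (rule primitive_bound[OF a b x, where g' = "\<lambda>x. r x * h' x + (a + b) * K x"])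
    show "continuous_on {0..1} g"
      unfolding g_def by (intro continuous_intros r_cont K_cont k_cont)
    show "g 0 = 0" "g 1 = 0" by (simp_all add: g_def r_ends K_ends)
  next
    fix u :: real assume u: "0 < u" "u < 1"
    show "(g has_real_derivative r u * h' u + (a + b) * K u) (at u)"
    proof -
      have "((\<lambda>x. a - (a + b) * x) has_real_derivative - (a + b)) (at u)"
        by (auto intro!: derivative_eq_intros)
      then have "(g has_real_derivative
          ((a - (a + b) * u) * p u * k u + h' u * r u) -
          (- (a + b) * K u + k u * p u * (a - (a + b) * u))) (at u)"
        unfolding g_def by (intro DERIV_diff DERIV_mult r' K' k' u)
      then show ?thesis by (simp add: algebra_simps)
    qed
    have "\<bar>r u * h' u\<bar> \<le> r u"
      using lip[OF u] r_pos[OF u] by (simp add: abs_mult)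
    moreover have "\<bar>(a + b) * K u\<bar> \<le> r u"
      using K_bound[OF u] a b by (simp add: abs_mult)
    ultimately show "\<bar>r u * h' u + (a + b) * K u\<bar> \<le> 2 * (u powr a * (1 - u) powr b)"
      unfolding r_def[symmetric] by linarith
  qed

  have q_eq: "x powr (a + 1) * (1 - x) powr (b + 1) = r x * (x * (1 - x))" if "0 < x" "x < 1" for x
    using that by (simp add: r_def powr_add)
  have f'_bound: "\<bar>f' x\<bar> \<le> 6" if x: "0 < x" "x < 1" for x
  proof -
    have "x powr (a + 1) * (1 - x) powr (b + 1) > 0" using x by simp
    then show ?thesis
      using g_bound[OF x] unfolding f'_def abs_divide by (simp add: pos_divide_le_eq)
  qed
  have f_bound: "(a + b) * \<bar>f x\<bar> \<le> 1" if x: "0 < x" "x < 1" for x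
    using K_bound[OF x] r_pos[OF x] x by (simp add: f_def pos_divide_le_eq)
  have eqn: "x * (1 - x) * f' x + (a - (a + b) * x) * f x = k x" if x: "0 \<le> x" "x \<le> 1" for x
  proof -
    consider "x = 0" | "x = 1" | "0 < x" "x < 1" using x by linarith
    then show ?thesis
    proof cases
      case 3
      have "x * (1 - x) * f' x = g x / r x"
        using 3 r_pos[OF 3] by (simp add: f'_def q_eq)
      moreover have "f x = K x / r x" using 3 by (simp add: f_def)
      moreover have "g x / r x = k x - (a - (a + b) * x) * (K x / r x)"
        using r_pos[OF 3] by (simp add: g_def diff_divide_distrib)
      ultimately show ?thesis by simp
    qed (use a b in \<open>auto simp: f_def\<close>)
  qed
  have f_deriv: "(f has_real_derivative f' x) (at x)" if x: "0 < x" "x < 1" for x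
  proof -
    have "((\<lambda>x. K x / r x) has_real_derivative
        (k x * p x * r x - K x * ((a - (a + b) * x) * p x)) / (r x * r x)) (at x)"
      by (rule DERIV_divide[OF K'[OF x] r'[OF x]]) (use r_pos[OF x] in auto)
    also have "(k x * p x * r x - K x * ((a - (a + b) * x) * p x)) / (r x * r x) = p x * g x / (r x * r x)"
      by (simp add: g_def algebra_simps)
    also have "\<dots> = f' x"
    proof -
      have "p x / r x = 1 / (x * (1 - x))"
        unfolding r_eq[OF x] using p_pos[OF x] by simp
      then have "g x / r x * (p x / r x) = g x / r x * (1 / (x * (1 - x)))" by simp
      then show ?thesis by (simp add: f'_def q_eq[OF x] mult.commute)
    qed
    finally show ?thesis
      by (rule has_field_derivative_transform_within_open[where S = "{0<..<1}"]) (use x in \<open>auto simp: f_def\<close>)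
  qed
  \<comment> \<open>As \<open>f'\<close> is bounded, the term \<open>x (1 - x) f' x\<close> tends to 0 at the ends, and the equation then
    determines the limit of \<open>f\<close>.\<close>
  have f_cont_end: "(f \<longlongrightarrow> f e) (at e within {0..1})" if e: "e = 0 \<or> e = 1" for e
  proof -
    have small: "((\<lambda>x. x * (1 - x) * f' x) \<longlongrightarrow> 0) (at e within {0..1})"
    proof (rule Lim_null_comparison)
      show "\<forall>\<^sub>F x in at e within {0..1}. norm (x * (1 - x) * f' x) \<le> 6 * (x * (1 - x))"
      proof (subst eventually_at_filter, intro always_eventually allI impI)
        fix x :: real assume "x \<noteq> e" "x \<in> {0..1}"
        then have "0 \<le> x" "x \<le> 1" by auto
        then consider "x = 0" | "x = 1" | "0 < x" "x < 1" by linarith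
        then show "norm (x * (1 - x) * f' x) \<le> 6 * (x * (1 - x))"
        proof cases
          case 3
          have "x * (1 - x) * \<bar>f' x\<bar> \<le> x * (1 - x) * 6"
            using f'_bound[OF 3] 3 by (intro mult_left_mono) auto
          then show ?thesis using 3 by (simp add: abs_mult)
        qed auto
      qed
      have "((\<lambda>x. 6 * (x * (1 - x))) \<longlongrightarrow> 6 * (e * (1 - e))) (at e within {0..1})"
        by (intro tendsto_intros)
      moreover have "6 * (e * (1 - e)) = 0" using e by auto
      ultimately show "((\<lambda>x. 6 * (x * (1 - x))) \<longlongrightarrow> 0) (at e within {0..1})" by (simp only:)
    qed
    have ne: "a - (a + b) * e \<noteq> 0" using e a b by auto
    have lin: "((\<lambda>x. a - (a + b) * x) \<longlongrightarrow> a - (a + b) * e) (at e within {0..1})"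
      by (intro tendsto_intros)
    have "(k \<longlongrightarrow> k e) (at e within {0..1})"
      using k_cont e by (auto simp: continuous_on_def)
    then have "((\<lambda>x. (k x - x * (1 - x) * f' x) / (a - (a + b) * x)) \<longlongrightarrow> (k e - 0) / (a - (a + b) * e)) (at e within {0..1})"
      by (intro tendsto_divide tendsto_diff small lin ne)
    moreover have "(k e - 0) / (a - (a + b) * e) = f e"
      using e a b by (auto simp: f_def)
    moreover have "\<forall>\<^sub>F x in at e within {0..1}. (k x - x * (1 - x) * f' x) / (a - (a + b) * x) = f x"
    proof -
      have "\<forall>\<^sub>F x in at e within {0..1}. a - (a + b) * x \<noteq> 0"
        using tendsto_imp_eventually_ne[OF lin ne] .
      moreover have "\<forall>\<^sub>F x in at e within {0..1}. x \<in> {0..1}"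
        by (simp add: eventually_at_filter)
      ultimately show ?thesis
      proof eventually_elim
        case (elim x)
        then have "k x - x * (1 - x) * f' x = (a - (a + b) * x) * f x" using eqn[of x] by simp
        then show ?case using elim by simp
      qed
    qed
    ultimately show ?thesis using Lim_transform_eventually by fastforce
  qed
  have f_cont: "continuous_on {0..1} f"
    unfolding continuous_on_def
  proof
    fix x :: real assume "x \<in> {0..1}"
    then have "0 \<le> x" "x \<le> 1" by auto
    then consider "x = 0 \<or> x = 1" | "0 < x" "x < 1" by linarith
    then show "(f \<longlongrightarrow> f x) (at x within {0..1})"
    proof cases
      case 2
      show ?thesis
        using DERIV_isCont[OF f_deriv[OF 2]] by (auto simp: isCont_def intro: tendsto_within_subset)
    qed (rule f_cont_end)
  qed
  show thesis
    by (rule that[of f f']) (use f_cont f_deriv f'_bound f_bound eqn in \<open>auto simp: k_def\<close>)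
qed

section \<open>From the Stein equation to the distance\<close>

text \<open>
  The derivative with respect to \<open>\<delta>\<close> of the expression on the left is \<open>w (1 - w) (f' y - f' w)\<close> with
  \<open>y = w + \<delta>\<close>. Up to the change of \<open>w (1 - w)\<close> into \<open>y (1 - y)\<close> this is an increment of the function
  \<open>x (1 - x) f' x\<close>, and the Stein equation writes this function as \<open>h x - c - (a - (a + b) x) f x\<close>,
  whose increments are at most a constant times \<open>y - w\<close>.
\<close>

lemma stein_difference_quotient:
  fixes a b c w \<delta> :: real and h f f' :: "real \<Rightarrow> real"
  assumes a: "a > 0" and b: "b > 0" and w: "0 < w" and \<delta>: "0 < \<delta>" "w + \<delta> \<le> 1"
    and h: "\<And>x y. 0 < x \<Longrightarrow> x \<le> y \<Longrightarrow> y < 1 \<Longrightarrow> \<bar>h y - h x\<bar> \<le> y - x"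
    and f_cont: "continuous_on {0..1} f"
    and f_deriv: "\<And>x. 0 < x \<Longrightarrow> x < 1 \<Longrightarrow> (f has_real_derivative f' x) (at x)"
    and f'_bound: "\<And>x. 0 < x \<Longrightarrow> x < 1 \<Longrightarrow> \<bar>f' x\<bar> \<le> L"
    and f_bound: "\<And>x. 0 < x \<Longrightarrow> x < 1 \<Longrightarrow> (a + b) * \<bar>f x\<bar> \<le> 1"
    and eqn: "\<And>x. 0 \<le> x \<Longrightarrow> x \<le> 1 \<Longrightarrow> x * (1 - x) * f' x + (a - (a + b) * x) * f x = h x - c"
  shows "\<bar>w * (1 - w) * (f (w + \<delta>) - f w) - \<delta> * (w * (1 - w) * f' w)\<bar>
    \<le> (2 + L * (1 + max a b)) * \<delta>\<^sup>2 / 2"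
proof -
  let ?\<psi> = "\<lambda>t. w * (1 - w) * f (w + t) - t * (w * (1 - w) * f' w)"
  let ?C = "2 + L * (1 + max a b)"
  let ?H = "\<lambda>t. ?C * t\<^sup>2 / 2"
  have L: "0 \<le> L" using f'_bound[of w] w \<delta> by force
  have "\<bar>?\<psi> \<delta> - ?\<psi> 0\<bar> \<le> ?H \<delta> - ?H 0"
  proof (rule abs_increment_le_by_derivative[where H' = "\<lambda>t. ?C * t"
        and \<phi>' = "\<lambda>t. w * (1 - w) * f' (w + t) - w * (1 - w) * f' w"])
    have "continuous_on {0..\<delta>} (\<lambda>t. f (w + t))"
      by (rule continuous_on_compose2[OF f_cont]) (use w \<delta> in \<open>auto intro!: continuous_intros\<close>)
    then show "continuous_on {0..\<delta>} ?\<psi>"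
      by (intro continuous_intros)
    show "continuous_on {0..\<delta>} ?H" by (intro continuous_intros) auto
  next
    fix t assume t: "0 < t" "t < \<delta>"
    define y where "y = w + t"
    have y: "0 < y" "y < 1" "w < y" "y - w = t" using t w \<delta> by (auto simp: y_def)
    have w1: "w < 1" using w \<delta> by simp
    have "((\<lambda>t. w + t) has_real_derivative 1) (at t)"
      by (auto intro!: derivative_eq_intros)
    then have "((\<lambda>t. f (w + t)) has_real_derivative f' y) (at t)"
      using DERIV_chain2[where f = f and g = "\<lambda>t. w + t" and x = t and Db = 1 and Da = "f' y"]
        f_deriv[OF y(1,2)] by (simp add: y_def)
    then have "((\<lambda>t. w * (1 - w) * f (w + t)) has_real_derivative w * (1 - w) * f' y) (at t)"
      by (rule DERIV_cmult)
    moreover have "((\<lambda>t. t * (w * (1 - w) * f' w)) has_real_derivative w * (1 - w) * f' w) (at t)"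
      by (auto intro!: derivative_eq_intros)
    ultimately show "(?\<psi> has_real_derivative w * (1 - w) * f' (w + t) - w * (1 - w) * f' w) (at t)"
      unfolding y_def by (rule DERIV_diff)
    show "(?H has_real_derivative ?C * t) (at t)"
      by (auto intro!: derivative_eq_intros)
    have f_diff: "\<bar>f y - f w\<bar> \<le> L * t"
    proof -
      have "\<bar>f y - f w\<bar> \<le> L * (y - w)"
      proof (rule abs_diff_le_by_derivative[where h' = f'])
        show "continuous_on {w..y} f"
          by (rule continuous_on_subset[OF f_cont]) (use y w in auto)
      qed (use y w f_deriv f'_bound in auto)
      then show ?thesis using y by simp
    qed
    have "y * (1 - y) * f' y - w * (1 - w) * f' w =
        (h y - h w) - (a - (a + b) * y) * (f y - f w) + t * ((a + b) * f w)"
      using eqn[of y] eqn[of w] y w w1 by (simp add: algebra_simps flip: y(4))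
    moreover have "\<bar>h y - h w\<bar> \<le> t" using h[of w y] y w by simp
    moreover have "\<bar>(a - (a + b) * y) * (f y - f w)\<bar> \<le> max a b * (L * t)"
      unfolding abs_mult
    proof (rule mult_mono[OF _ f_diff])
      have "a - (a + b) * y = a * (1 - y) - b * y" by (simp add: algebra_simps)
      moreover have "0 \<le> a * (1 - y)" "a * (1 - y) \<le> a" "0 \<le> b * y" "b * y \<le> b"
        using a b y by (auto simp: mult_left_le)
      ultimately show "\<bar>a - (a + b) * y\<bar> \<le> max a b" by linarith
    qed (use a in auto)
    moreover have "\<bar>t * ((a + b) * f w)\<bar> \<le> t"
      using f_bound[OF w w1] a b t by (simp add: abs_mult mult_left_le)
    ultimately have 1: "\<bar>y * (1 - y) * f' y - w * (1 - w) * f' w\<bar> \<le> t + max a b * (L * t) + t"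
      by linarith
    have "\<bar>(w * (1 - w) - y * (1 - y)) * f' y\<bar> \<le> t * L"
      unfolding abs_mult
    proof (rule mult_mono[OF _ f'_bound])
      have "w * (1 - w) - y * (1 - y) = t * (w + y - 1)"
        by (simp add: algebra_simps flip: y(4))
      moreover have "\<bar>w + y - 1\<bar> \<le> 1" using y w w1 by linarith
      ultimately show "\<bar>w * (1 - w) - y * (1 - y)\<bar> \<le> t"
        using t by (simp add: abs_mult mult_left_le)
    qed (use y t in auto)
    moreover have "w * (1 - w) * f' y - w * (1 - w) * f' w =
        (y * (1 - y) * f' y - w * (1 - w) * f' w) + (w * (1 - w) - y * (1 - y)) * f' y"
      by (simp add: algebra_simps)
    ultimately have "\<bar>w * (1 - w) * f' y - w * (1 - w) * f' w\<bar> \<le> t + max a b * (L * t) + t + t * L"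
      using 1 by linarith
    also have "\<dots> = ?C * t" by (simp add: algebra_simps)
    finally show "\<bar>w * (1 - w) * f' (w + t) - w * (1 - w) * f' w\<bar> \<le> ?C * t"
      by (simp add: y_def)
  qed (use \<delta> in auto)
  then show ?thesis by (simp add: algebra_simps)
qed

text \<open>
  Stein's method for a discrete law \<open>p\<close> on \<open>{0..n}\<close> with the ratio of the beta-binomial law. The term
  \<open>T k\<close> has mean zero by the discrete Stein identity and differs from \<open>h (k / n) - c\<close> by \<open>O (1 / n)\<close>.
\<close>

lemma wasserstein_bound_smooth:
  fixes p :: "nat \<Rightarrow> real" and a b c :: real and h h' :: "real \<Rightarrow> real" and n :: nat
  assumes a: "a > 0" and b: "b > 0" and n: "n \<ge> 1"
    and p_nonneg: "\<And>k. 0 \<le> p k" and p_sum: "(\<Sum>k\<le>n. p k) = 1"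
    and ratio: "\<And>k. Suc k * (b + n - Suc k) * p (Suc k) = (real n - k) * (a + k) * p k"
    and h: "continuous_on {0..1} h"
    and h': "\<And>x. 0 < x \<Longrightarrow> x < 1 \<Longrightarrow> (h has_real_derivative h' x) (at x)"
    and lip: "\<And>x. 0 < x \<Longrightarrow> x < 1 \<Longrightarrow> \<bar>h' x\<bar> \<le> 1"
    and c: "((\<lambda>x. (h x - c) * (x powr (a - 1) * (1 - x) powr (b - 1))) has_integral 0) {0..1}"
  shows "\<bar>(\<Sum>k\<le>n. p k * h (k / n)) - c\<bar> \<le> 1 / n + 6 * ((1 + max a b) / (2 * n) + a * b / (n * (a + b)))"
proof -
  obtain f f' where f_cont: "continuous_on {0..1} f"
    and f_deriv: "\<And>x. 0 < x \<Longrightarrow> x < 1 \<Longrightarrow> (f has_real_derivative f' x) (at x)"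
    and f'_bound: "\<And>x. 0 < x \<Longrightarrow> x < 1 \<Longrightarrow> \<bar>f' x\<bar> \<le> 6"
    and f_bound: "\<And>x. 0 < x \<Longrightarrow> x < 1 \<Longrightarrow> (a + b) * \<bar>f x\<bar> \<le> 1"
    and eqn: "\<And>x. 0 \<le> x \<Longrightarrow> x \<le> 1 \<Longrightarrow> x * (1 - x) * f' x + (a - (a + b) * x) * f x = h x - c"
    using stein_equation_solution[OF a b h h' lip c] by blast
  have h_diff: "\<bar>h y - h x\<bar> \<le> y - x" if "0 < x" "x \<le> y" "y < 1" for x y
  proof -
    have "\<bar>h y - h x\<bar> \<le> 1 * (y - x)"
    proof (rule abs_diff_le_by_derivative[where h' = h'])
      show "continuous_on {x..y} h"
        by (rule continuous_on_subset[OF h]) (use that in auto)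
    qed (use that h' lip in auto)
    then show ?thesis by simp
  qed
  define T where "T k = n * (k / n) * (1 - k / n) * (f (Suc k / n) - f (k / n))
      + a * (1 - k / n) * f (Suc k / n) - b * (k / n) * f (k / n)" for k :: nat
  have "(\<Sum>k\<le>n. p k * (n * T k)) =
      (\<Sum>k\<le>n. p k * ((real n - k) * (a + k) * f (Suc k / n))) - (\<Sum>k\<le>n. p k * (k * (b + n - k) * f (k / n)))"
    unfolding sum_subtractf[symmetric] T_def using n
    by (intro sum.cong refl) (simp add: field_simps)
  also have "\<dots> = 0"
    using sum_characterisation[OF ratio, of "\<lambda>k. f (k / n)"] by simp
  also have "(\<Sum>k\<le>n. p k * (n * T k)) = n * (\<Sum>k\<le>n. p k * T k)"
    by (simp add: sum_distrib_left mult.left_commute)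
  finally have T_sum: "(\<Sum>k\<le>n. p k * T k) = 0" using n by simp
  \<comment> \<open>The discrete Stein identity for the constant function 1.\<close>
  have mean: "(\<Sum>k\<le>n. p k * (1 - k / n)) = b / (a + b)"
  proof -
    have "(\<Sum>k\<le>n. p k * (k * (b + n - k) * 1)) = (\<Sum>k\<le>n. p k * ((real n - k) * (a + k) * 1))"
      using sum_characterisation[OF ratio, of "\<lambda>_. 1"] .
    then have "0 = (\<Sum>k\<le>n. p k * (k * (b + n - k) * 1)) - (\<Sum>k\<le>n. p k * ((real n - k) * (a + k) * 1))" by simp
    also have "\<dots> = (\<Sum>k\<le>n. n * b * p k - n * (a + b) * (p k * (1 - k / n)))"
      unfolding sum_subtractf[symmetric] using n
      by (intro sum.cong refl) (simp add: field_simps)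
    also have "\<dots> = n * b * (\<Sum>k\<le>n. p k) - n * (a + b) * (\<Sum>k\<le>n. p k * (1 - k / n))"
      by (simp only: sum_subtractf sum_distrib_left)
    finally have "real n * b * 1 = real n * (a + b) * (\<Sum>k\<le>n. p k * (1 - k / n))"
      unfolding p_sum by (simp only: right_minus_eq eq_commute[of 0])
    then have "real n * ((a + b) * (\<Sum>k\<le>n. p k * (1 - k / n))) = real n * b"
      by (simp only: mult.assoc mult_1_right)
    then have "(a + b) * (\<Sum>k\<le>n. p k * (1 - k / n)) = b" using n by simp
    then show ?thesis using a b by (metis add_pos_pos less_numeral_extra(3) nonzero_mult_div_cancel_left)
  qed
  let ?C = "2 + 6 * (1 + max a b)"
  have T_bound: "\<bar>T k - (h (k / n) - c)\<bar> \<le> ?C / (2 * n) + 6 * a * (1 - k / n) / n" if "k \<le> n" for k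
  proof (cases "k = n")
    case True
    have "T k - (h (k / n) - c) = 0"
      using eqn[of 1] n by (simp add: T_def True)
    moreover have "0 \<le> ?C / (2 * n) + 6 * a * (1 - k / n) / n" using a True by (simp add: le_max_iff_disj)
    ultimately show ?thesis by simp
  next
    case False
    define w \<delta> where "w = k / n" and "\<delta> = 1 / real n"
    have kn: "real k + 1 \<le> n" using that False by simp
    have w: "0 \<le> w" "0 < \<delta>" "w + \<delta> \<le> 1" "w < 1" and w_Suc: "Suc k / n = w + \<delta>" and n_eq: "real n = 1 / \<delta>"
      using n kn by (auto simp: w_def \<delta>_def field_simps)
    have f_diff: "\<bar>f (w + \<delta>) - f w\<bar> \<le> 6 * \<delta>"
    proof -
      have "\<bar>f (w + \<delta>) - f w\<bar> \<le> 6 * ((w + \<delta>) - w)"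
      proof (rule abs_diff_le_by_derivative[where h' = f'])
        show "continuous_on {w..w + \<delta>} f"
          by (rule continuous_on_subset[OF f_cont]) (use w in auto)
      qed (use w f_deriv f'_bound in auto)
      then show ?thesis by simp
    qed
    have "\<bar>w * (1 - w) * (f (w + \<delta>) - f w) - \<delta> * (w * (1 - w) * f' w)\<bar> \<le> ?C * \<delta>\<^sup>2 / 2"
    proof (cases "w = 0")
      case False
      with w show ?thesis
        by (intro stein_difference_quotient[OF a b _ _ _ h_diff f_cont f_deriv f'_bound f_bound eqn]) auto
    qed (use a in \<open>auto simp: le_max_iff_disj\<close>)
    then have quotient: "\<bar>(w * (1 - w) * (f (w + \<delta>) - f w) - \<delta> * (w * (1 - w) * f' w)) / \<delta>\<bar> \<le> ?C * \<delta> / 2"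
      using w by (simp add: abs_divide pos_divide_le_eq power2_eq_square mult.assoc)
    have shift: "\<bar>a * (1 - w) * (f (w + \<delta>) - f w)\<bar> \<le> a * (1 - w) * (6 * \<delta>)"
      unfolding abs_mult[of "a * (1 - w)"] using a w f_diff by (simp add: abs_mult mult_left_mono)
    have "T k - (h w - c) =
       (w * (1 - w) * (f (w + \<delta>) - f w) - \<delta> * (w * (1 - w) * f' w)) / \<delta> + a * (1 - w) * (f (w + \<delta>) - f w)"
    proof -
      have "h w - c = w * (1 - w) * f' w + (a - (a + b) * w) * f w" using eqn[of w] w by simp
      moreover have "T k = 1 / \<delta> * w * (1 - w) * (f (w + \<delta>) - f w) + a * (1 - w) * f (w + \<delta>) - b * w * f w"
        by (simp only: T_def w_Suc w_def[symmetric]) (simp only: n_eq)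
      moreover have "(w * (1 - w) * (f (w + \<delta>) - f w) - \<delta> * (w * (1 - w) * f' w)) / \<delta>
          = 1 / \<delta> * w * (1 - w) * (f (w + \<delta>) - f w) - w * (1 - w) * f' w"
        using w by (simp add: diff_divide_distrib)
      ultimately show ?thesis by (simp add: algebra_simps)
    qed
    then have "\<bar>T k - (h w - c)\<bar> \<le> ?C * \<delta> / 2 + a * (1 - w) * (6 * \<delta>)"
      using order_trans[OF abs_triangle_ineq add_mono[OF quotient shift]] by (simp only:)
    also have "\<dots> = ?C / (2 * n) + 6 * a * (1 - w) / n"
      by (simp add: n_eq)
    finally show ?thesis unfolding w_def .
  qed
  have "(\<Sum>k\<le>n. p k * h (k / n)) - c = (\<Sum>k\<le>n. p k * (h (k / n) - c)) - (\<Sum>k\<le>n. p k * T k)"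
    using p_sum by (simp add: T_sum right_diff_distrib sum_subtractf flip: sum_distrib_right)
  also have "\<dots> = - (\<Sum>k\<le>n. p k * (T k - (h (k / n) - c)))"
    by (simp add: right_diff_distrib sum_subtractf)
  finally have "\<bar>(\<Sum>k\<le>n. p k * h (k / n)) - c\<bar> = \<bar>\<Sum>k\<le>n. p k * (T k - (h (k / n) - c))\<bar>" by simp
  also have "\<dots> \<le> (\<Sum>k\<le>n. p k * (?C / (2 * n) + 6 * a / n * (1 - k / n)))"
    using T_bound p_nonneg by (intro sum_abs[THEN order_trans] sum_mono) (auto simp: abs_mult mult_left_mono)
  also have "\<dots> = (\<Sum>k\<le>n. ?C / (2 * n) * p k + 6 * a / n * (p k * (1 - k / n)))"
    by (intro sum.cong refl) (simp only: distrib_left mult_ac)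
  also have "\<dots> = ?C / (2 * n) * (\<Sum>k\<le>n. p k) + 6 * a / n * (\<Sum>k\<le>n. p k * (1 - k / n))"
    by (simp only: sum.distrib sum_distrib_left)
  also have "\<dots> = 1 / n + 6 * ((1 + max a b) / (2 * n) + a * b / (n * (a + b)))"
    unfolding mean p_sum using n a b by (simp add: add_divide_distrib)
  finally show ?thesis .
qed

text \<open>
  The moving average of \<open>h\<close> over \<open>[x, x + e]\<close> has the derivative \<open>(h (x + e) - h x) / e\<close>, which is
  at most 1 in absolute value because \<open>h\<close> is 1-Lipschitz.
\<close>

lemma smooth_lipschitz_approximation:
  fixes h :: "real \<Rightarrow> real"
  assumes lip: "1-lipschitz_on UNIV h" and e: "0 < e" "e \<le> 1"
  obtains g g' where "continuous_on {0..1} g"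
    and "\<And>x. 0 < x \<Longrightarrow> x < 1 \<Longrightarrow> (g has_real_derivative g' x) (at x)"
    and "\<And>x. 0 < x \<Longrightarrow> x < 1 \<Longrightarrow> \<bar>g' x\<bar> \<le> 1"
    and "\<And>x. 0 \<le> x \<Longrightarrow> x \<le> 1 \<Longrightarrow> \<bar>g x - h x\<bar> \<le> e"
proof -
  have h_diff: "\<bar>h x - h y\<bar> \<le> \<bar>x - y\<bar>" for x y
    using lipschitz_onD[OF lip, of x y] by (simp add: dist_real_def)
  have h_cont: "continuous_on S h" for S
    using lipschitz_on_continuous_on[OF lip] continuous_on_subset by blast
  \<comment> \<open>The lower limit is below 0, so that \<open>H\<close> is differentiable on a neighbourhood of \<open>[0, 1]\<close>.\<close>
  define H where "H x = integral {-1..x} h" for x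
  have H': "(H has_real_derivative h x) (at x)" if "-1 < x" "x < 3" for x
    using integral_has_real_derivative[of "-1" 3 h x] that
    by (simp add: H_def[abs_def] h_cont at_within_Icc_at)
  have g': "((\<lambda>x. (H (x + e) - H x) / e) has_real_derivative (h (x + e) - h x) / e) (at x)" if "-1 < x" "x < 2" for x
  proof -
    have "((\<lambda>x. x + e) has_real_derivative 1) (at x)"
      by (auto intro!: derivative_eq_intros)
    then have "((\<lambda>x. H (x + e)) has_real_derivative h (x + e)) (at x)"
      using DERIV_chain2[where f = H and g = "\<lambda>x. x + e" and x = x and Db = 1 and Da = "h (x + e)"]
        H'[of "x + e"] that e by simp
    then show ?thesis
      by (intro DERIV_cdivide DERIV_diff H' that) (use that in auto)
  qed
  show thesis
  proof (rule that[of "\<lambda>x. (H (x + e) - H x) / e" "\<lambda>x. (h (x + e) - h x) / e"])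
    show "continuous_on {0..1} (\<lambda>x. (H (x + e) - H x) / e)"
      by (intro continuous_at_imp_continuous_on ballI DERIV_isCont[OF g']) auto
    fix x :: real assume x: "0 \<le> x" "x \<le> 1"
    obtain z where z: "x < z" "z < x + e" "H (x + e) - H x = (x + e - x) * h z"
      using MVT2[of x "x + e" H h] H' x e by auto
    have "(H (x + e) - H x) / e = h z" using z(3) e by simp
    then show "\<bar>(H (x + e) - H x) / e - h x\<bar> \<le> e" using h_diff[of z x] z(1,2) by simp
  qed (use g' h_diff e in \<open>auto simp: abs_divide divide_le_eq intro: order_trans[OF h_diff]\<close>)
qed

text \<open>
  The right-hand side of the smooth case does not depend on the test function, so it survives a
  uniform approximation.
\<close>

lemma wasserstein_bound_lipschitz:
  fixes p :: "nat \<Rightarrow> real" and a b :: real and h :: "real \<Rightarrow> real" and n :: nat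
  assumes a: "a > 0" and b: "b > 0" and n: "n \<ge> 1"
    and p_nonneg: "\<And>k. 0 \<le> p k" and p_sum: "(\<Sum>k\<le>n. p k) = 1"
    and ratio: "\<And>k. Suc k * (b + n - Suc k) * p (Suc k) = (real n - k) * (a + k) * p k"
    and lip: "1-lipschitz_on UNIV h"
  shows "\<bar>(\<Sum>k\<le>n. p k * h (k / n)) - beta_mean a b h\<bar> \<le> 1 / n + 6 * ((1 + max a b) / (2 * n) + a * b / (n * (a + b)))"
proof -
  let ?B = "1 / n + 6 * ((1 + max a b) / (2 * n) + a * b / (n * (a + b)))"
  have "\<bar>(\<Sum>k\<le>n. p k * h (k / n)) - beta_mean a b h\<bar> \<le> ?B + e" if e: "0 < e" "e \<le> 1" for e
  proof -
    have h_cont: "continuous_on {0..1} h"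
      using lipschitz_on_continuous_on[OF lip] continuous_on_subset by blast
    obtain g g' where g: "continuous_on {0..1} g"
      "\<And>x. 0 < x \<Longrightarrow> x < 1 \<Longrightarrow> (g has_real_derivative g' x) (at x)"
      "\<And>x. 0 < x \<Longrightarrow> x < 1 \<Longrightarrow> \<bar>g' x\<bar> \<le> 1"
      and close: "\<And>x. 0 \<le> x \<Longrightarrow> x \<le> 1 \<Longrightarrow> \<bar>g x - h x\<bar> \<le> e / 2"
      using smooth_lipschitz_approximation[OF lip, of "e / 2"] e by auto
    have "\<bar>(\<Sum>k\<le>n. p k * g (k / n)) - (\<Sum>k\<le>n. p k * h (k / n))\<bar> = \<bar>\<Sum>k\<le>n. p k * (g (k / n) - h (k / n))\<bar>"
      by (simp add: right_diff_distrib sum_subtractf)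
    also have "\<dots> \<le> (\<Sum>k\<le>n. p k * (e / 2))"
    proof (intro sum_abs[THEN order_trans] sum_mono)
      fix k assume "k \<in> {..n}"
      then have "\<bar>g (k / n) - h (k / n)\<bar> \<le> e / 2" using n by (intro close) auto
      then show "\<bar>p k * (g (k / n) - h (k / n))\<bar> \<le> p k * (e / 2)"
        unfolding abs_mult abs_of_nonneg[OF p_nonneg] by (intro mult_left_mono p_nonneg)
    qed
    also have "\<dots> = e / 2" using p_sum by (simp flip: sum_distrib_right sum_divide_distrib)
    finally have "\<bar>(\<Sum>k\<le>n. p k * g (k / n)) - (\<Sum>k\<le>n. p k * h (k / n))\<bar> \<le> e / 2" .
    moreover have "\<bar>beta_mean a b g - beta_mean a b h\<bar> \<le> e / 2"
      by (rule beta_mean_diff_le[OF a b h_cont g(1) close])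
    moreover have "\<bar>(\<Sum>k\<le>n. p k * g (k / n)) - beta_mean a b g\<bar> \<le> ?B"
      by (rule wasserstein_bound_smooth[OF a b n p_nonneg p_sum ratio g beta_mean_centred[OF a b g(1)]])
    ultimately show ?thesis by linarith
  qed
  then have bound: "\<bar>(\<Sum>k\<le>n. p k * h (k / n)) - beta_mean a b h\<bar> \<le> ?B + e" if "0 < e" for e
    using that by (cases "e \<le> 1") (auto dest: spec[of _ 1] intro: order_trans[where y = "?B + 1"])
  show ?thesis by (rule field_le_epsilon) (rule bound)
qed

section \<open>The bound in terms of the two constants\<close>

text \<open>
  The first summand of \<open>b1\<close> is at least 4, in the last three cases because \<open>(x + y)\<^sup>2\<close> is at least
  four times \<open>(min x y)\<^sup>2\<close>. The remaining one contributes at least 2, and \<open>b0\<close> is nonnegative.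
\<close>

lemma b0_plus_b1_ge_6:
  fixes a b :: real
  assumes "a > 0" "b > 0"
  shows "6 \<le> b0 a b + b1 a b"
proof -
  have sq: "4 * x\<^sup>2 \<le> (x + y)\<^sup>2" if "0 \<le> x" "x \<le> y" for x y :: real
    using power_mono[of "2 * x" "x + y" 2] that by (simp add: power_mult_distrib)
  have four: "4 \<le> (x + y)\<^sup>2 / (min x y)\<^sup>2" if "x > 0" "y > 0" for x y :: real
    using sq[of x y] sq[of y x] that by (auto simp: min_def field_simps)
  consider "a \<le> 2" "b \<le> 2" | "a > 2" "b \<le> 2" | "a \<le> 2" "b > 2" | "a > 2" "b > 2" by linarith
  then show ?thesis
  proof cases
    case 1
    have "1 / 2 \<le> max a b / (a + b)" using assms by (auto simp: field_simps)
    moreover have "0 \<le> max \<bar>a - 1\<bar> \<bar>b - 1\<bar>" by auto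
    ultimately show ?thesis using 1 by (simp add: b0_def b1_def)
  next
    case 2
    have "0 \<le> (a + b - 2)\<^sup>2 * max ((a - 1) / (a - 2)\<^sup>2) (\<bar>b - 1\<bar> / b\<^sup>2)"
      by (intro mult_nonneg_nonneg) (auto simp: le_max_iff_disj)
    moreover have "2 \<le> 2 * a / (a - 2)" using 2 by (simp add: field_simps)
    moreover have "4 \<le> (a + b - 2)\<^sup>2 / (min (a - 2) b)\<^sup>2" using four[of "a - 2" b] 2 assms by (simp add: algebra_simps)
    ultimately show ?thesis using 2 by (simp add: b0_def b1_def)
  next
    case 3
    have "0 \<le> (a + b - 2)\<^sup>2 * max (\<bar>a - 1\<bar> / a\<^sup>2) ((b - 1) / (b - 2)\<^sup>2)"
      by (intro mult_nonneg_nonneg) (auto simp: le_max_iff_disj)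
    moreover have "2 \<le> 2 * b / (b - 2)" using 3 by (simp add: field_simps)
    moreover have "4 \<le> (a + b - 2)\<^sup>2 / (min a (b - 2))\<^sup>2" using four[of a "b - 2"] 3 assms by (simp add: algebra_simps)
    ultimately show ?thesis using 3 by (simp add: b0_def b1_def)
  next
    case 4
    have "0 \<le> (a + b - 2)\<^sup>2 * max (1 / (a - 1)) (1 / (b - 1))"
      using 4 by (intro mult_nonneg_nonneg) (auto simp: le_max_iff_disj)
    moreover have "1 \<le> max (a / (a - 1)) (b / (b - 1))" using 4 by (simp add: le_max_iff_disj)
    moreover have "4 \<le> (a + b - 2)\<^sup>2 / (min (a - 1) (b - 1))\<^sup>2" using four[of "a - 1" "b - 1"] 4 by (simp add: algebra_simps)
    ultimately show ?thesis using 4 by (simp add: b0_def b1_def)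
  qed
qed

theorem theorem1p1:
  fixes \<alpha> \<beta> m n :: nat
    and M :: "'a measure" and D :: "nat \<Rightarrow> 'a \<Rightarrow> colour"
    and N :: "'b measure" and Z :: "'b \<Rightarrow> real"
  assumes "\<alpha> \<ge> 1" and "\<beta> \<ge> 1" and "m \<ge> 1" and "n \<ge> 1"
    and "prob_space M" and "polya_urn M \<alpha> \<beta> m D"
    and "prob_space N"
    and "distributed N lborel Z (\<lambda>x. ennreal (beta_density (real \<alpha> / real m) (real \<beta> / real m) x))"
  shows "wasserstein_dist M (\<lambda>\<omega>. real (white_draws D n \<omega>) / real n) N Z
    \<le> ereal (((real m + max (real \<alpha>) (real \<beta>)) / (2 * real n * real m)
                + real \<alpha> * real \<beta> / (real n * real m * (real \<alpha> + real \<beta>)))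
              * (b0 (real \<alpha> / real m) (real \<beta> / real m) + b1 (real \<alpha> / real m) (real \<beta> / real m))
              + 3 / (2 * real n))"
proof -
  interpret M: prob_space M by fact
  define a b where "a = real \<alpha> / real m" and "b = real \<beta> / real m"
  define p where "p k = \<P>(\<omega> in M. white_draws D n \<omega> = k)" for k
  let ?A = "(1 + max a b) / (2 * n) + a * b / (n * (a + b))"
  have a: "a > 0" and b: "b > 0" using assms by (auto simp: a_def b_def)
  note law = white_draws_law_Suc[OF assms(5,6,1,3), folded a_def b_def]
  have ratio: "Suc k * (b + n - Suc k) * p (Suc k) = (real n - k) * (a + k) * p k" for k
    unfolding p_def
  proof (rule ratio_from_urn_recursion[OF a b _ law])
    show "\<P>(\<omega> in M. white_draws D 0 \<omega> = k) = 0" if "k > 0" for k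
      using that by (simp add: white_draws_def)
  qed
  have p_sum: "(\<Sum>k\<le>n. p k) = 1"
    using expectation_white_draws[OF assms(5,6), of "\<lambda>_. 1" n] by (simp add: p_def M.prob_space)
  have "\<bar>(\<integral>\<omega>. h (real (white_draws D n \<omega>) / n) \<partial>M) - (\<integral>\<omega>. h (Z \<omega>) \<partial>N)\<bar>
      \<le> ?A * (b0 a b + b1 a b) + 3 / (2 * n)" if lip: "1-lipschitz_on UNIV h" for h :: "real \<Rightarrow> real"
  proof -
    have "\<bar>(\<Sum>k\<le>n. p k * h (k / n)) - beta_mean a b h\<bar> \<le> 1 / n + 6 * ?A"
      by (rule wasserstein_bound_lipschitz[OF a b \<open>n \<ge> 1\<close> _ p_sum ratio lip]) (simp add: p_def)
    also have "\<dots> \<le> 3 / (2 * n) + (b0 a b + b1 a b) * ?A"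
    proof (intro add_mono mult_right_mono b0_plus_b1_ge_6 a b)
      show "1 / real n \<le> 3 / (2 * n)" using \<open>n \<ge> 1\<close> by (simp add: field_simps)
      show "0 \<le> ?A" using a b by (intro add_nonneg_nonneg divide_nonneg_nonneg) auto
    qed
    also have "(\<Sum>k\<le>n. p k * h (k / n)) = (\<integral>\<omega>. h (real (white_draws D n \<omega>) / n) \<partial>M)"
      using expectation_white_draws[OF assms(5,6), of h n] by (simp add: p_def)
    also have "beta_mean a b h = (\<integral>\<omega>. h (Z \<omega>) \<partial>N)"
      by (rule expectation_beta[symmetric, OF a b])
        (use assms(8) lipschitz_on_continuous_on[OF lip] in \<open>auto simp: a_def b_def\<close>)
    finally show ?thesis by (simp only: mult.commute add.commute)
  qed
  moreover have "?A = (real m + max (real \<alpha>) (real \<beta>)) / (2 * real n * real m)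
      + real \<alpha> * real \<beta> / (real n * real m * (real \<alpha> + real \<beta>))"
  proof -
    have eq: "real \<alpha> = m * a" "real \<beta> = m * b" using \<open>m \<ge> 1\<close> by (auto simp: a_def b_def)
    have "max (real \<alpha>) (real \<beta>) = m * max a b"
      unfolding eq by (simp add: max_mult_distrib_left)
    then have "real m + max (real \<alpha>) (real \<beta>) = m * (1 + max a b)" by (simp add: algebra_simps)
    moreover have "real \<alpha> * real \<beta> / (real n * real m * (real \<alpha> + real \<beta>)) = a * b / (n * (a + b))"
    proof -
      have "real \<alpha> * real \<beta> = (m * m) * (a * b)" "real n * real m * (real \<alpha> + real \<beta>) = (m * m) * (n * (a + b))"
        unfolding eq by (simp_all add: algebra_simps)
      then have "real \<alpha> * real \<beta> / (real n * real m * (real \<alpha> + real \<beta>)) =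
          (m * m) * (a * b) / ((m * m) * (n * (a + b)))" by (simp only:)
      also have "\<dots> = a * b / (n * (a + b))"
        by (rule mult_divide_mult_cancel_left) (use \<open>m \<ge> 1\<close> in simp)
      finally show ?thesis .
    qed
    ultimately show ?thesis using \<open>m \<ge> 1\<close> by simp
  qed
  ultimately show ?thesis
    unfolding wasserstein_dist_def a_def[symmetric] b_def[symmetric]
    by (intro SUP_least) auto
qed

end
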